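(* Let $\mathfrak{O}$ be the valuation ring of a non-Archimedean local field $K$ of arbitrary characteristic, with residue field size $q$. Let $M \subset \mathrm{M}_{d\times e}(\mathfrak{O})$ be a submodule and $V = \mathfrak{O}^d$. Then for all $s \in \mathbf{C}$ with $\mathrm{Re}(s) > d$, $$(1-q^{-1})\cdot \mathsf{Z}_M(q^{-s}) = \int_{M\times \mathfrak{O}} |y|^{s-1}\cdot \mathrm{K}_M(a,y)\, d\mu_{M\times\mathfrak{O}}(a,y) = \int_{V\times\mathfrak{O}} \frac{|y|^{s-d-1}}{\mathrm{O}_M(x,y)}\, d\mu_{V\times\mathfrak{O}}(x,y).$$
   Context: Let $\mathfrak{P}$ be the maximal ideal of $\mathfrak{O}$ and $\mathfrak{O}_n=\mathfrak{O}/\mathfrak{P}^n$. Let $|\cdot|$ be the absolute value on $K$ with $|\pi|=q^{-1}$ for $\pi\in\mathfrak{P}\setminus\mathfrak{P}^2$. For a free $\mathfrak{O}$-module $W$ of finite rank, $\mu_W$ is the Haar measure on $W$ with $\mu_W(W)=1$. Matrices act by right multiplication on row vectors. The ask zeta function of $M$ is $\mathsf{Z}_M(T)=\sum_{n=0}^\infty \bigl(|M_n|^{-1}\sum_{a\in M_n}|\mathrm{Ker}(a)|\bigr)T^n$, where $M_n\subset \mathrm{M}_{d\times e}(\mathfrak{O}_n)$ is the image of $M$ under entrywise reduction modulo $\mathfrak{P}^n$ and $\mathrm{Ker}(a)=\{x\in\mathfrak{O}_n^d: xa=0\}$. With $W=\mathfrak{O}^e$, define $\mathrm{K}_M\colon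 M\times\mathfrak{O}\to\mathbf{N}_0\cup\{\infty\}$ by letting $\mathrm{K}_M(a,y)$ be the cardinality of the kernel of the map $V\otimes\mathfrak{O}/(y)\to W\otimes\mathfrak{O}/(y)$ induced by $a$, and $\mathrm{O}_M\colon V\times\mathfrak{O}\to\mathbf{N}_0\cup\{\infty\}$ by letting $\mathrm{O}_M(x,y)$ be the cardinality of the image of $xM=\{xa:a\in M\}\subset W$ in $W\otimes\mathfrak{O}/(y)$. (The set where $y=0$ has measure zero and may be ignored.) *)

theory Defs
  imports
    "HOL-Analysis.Analysis"
    "HOL-Algebra.Module"
    "HOL-Algebra.QuotRing"
    "HOL-Algebra.Ideal_Product"
begin

text \<open>
  A field is a type of class \<open>field\<close> with an absolute value \<open>v\<close>; its valuation ring is a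
  \<open>HOL-Algebra\<close> ring, so that quotients, ideal powers and submodules are those of the library.
\<close>

definition val_ring :: "('a::field \<Rightarrow> real) \<Rightarrow> 'a ring" where
  "val_ring v = \<lparr>carrier = {x. v x \<le> 1}, mult = (*), one = 1, zero = 0, add = (+)\<rparr>"

definition max_ideal :: "('a::field \<Rightarrow> real) \<Rightarrow> 'a set" where
  "max_ideal v = {x. v x < 1}"

definition max_ideal_pow :: "('a::field \<Rightarrow> real) \<Rightarrow> nat \<Rightarrow> 'a set" where
  "max_ideal_pow v n = max_ideal v [^]\<^bsub>ideals_set (val_ring v)\<^esub> n"

definition residue_size :: "('a::field \<Rightarrow> real) \<Rightarrow> nat" where
  "residue_size v = card (carrier (val_ring v Quot max_ideal v))"

text \<open>
  A non-Archimedean local field: complete with respect to a (non-trivial) discrete valuation,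
  with finite residue field; the absolute value is the normalised one.
\<close>

locale nonarch_local_field =
  fixes v :: "'a::field \<Rightarrow> real"
  assumes nonneg: "0 \<le> v x"
    and eq_zero_iff: "v x = 0 \<longleftrightarrow> x = 0"
    and mult: "v (x * y) = v x * v y"
    and ultrametric: "v (x + y) \<le> max (v x) (v y)"
    and complete: "Metric_space.mcomplete UNIV (\<lambda>x y. v (x - y))"
    and discrete: "\<exists>\<pi>. \<pi> \<noteq> 0 \<and> max_ideal v = PIdl\<^bsub>val_ring v\<^esub> \<pi>"
    and finite_residue_field: "finite (carrier (val_ring v Quot max_ideal v))"
    and normalised:
      "\<pi> \<in> max_ideal_pow v 1 - max_ideal_pow v 2 \<Longrightarrow> v \<pi> = 1 / real (residue_size v)"

text \<open>
  The free module \<open>R\<^sup>J\<close>. Row vectors of length \<open>d\<close> are the case \<open>J = {..<d}\<close>, and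
  \<open>d \<times> e\<close> matrices the case \<open>J = {..<d} \<times> {..<e}\<close>. The multiplicative components, which the
  record type \<open>module\<close> requires, play no role.
\<close>

definition free_module :: "('a, 'm) ring_scheme \<Rightarrow> 'i set \<Rightarrow> ('a, 'i \<Rightarrow> 'a) module" where
  "free_module R J =
    \<lparr>carrier = J \<rightarrow>\<^sub>E carrier R,
     mult = (\<lambda>f g. \<lambda>j\<in>J. f j \<otimes>\<^bsub>R\<^esub> g j),
     one = (\<lambda>j\<in>J. \<one>\<^bsub>R\<^esub>),
     zero = (\<lambda>j\<in>J. \<zero>\<^bsub>R\<^esub>),
     add = (\<lambda>f g. \<lambda>j\<in>J. f j \<oplus>\<^bsub>R\<^esub> g j),
     smult = (\<lambda>c f. \<lambda>j\<in>J. c \<otimes>\<^bsub>R\<^esub> f j)\<rparr>"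

abbreviation row_module :: "('a, 'm) ring_scheme \<Rightarrow> nat \<Rightarrow> ('a, nat \<Rightarrow> 'a) module" where
  "row_module R d \<equiv> free_module R {..<d}"

abbreviation matrix_module ::
    "('a, 'm) ring_scheme \<Rightarrow> nat \<Rightarrow> nat \<Rightarrow> ('a, nat \<times> nat \<Rightarrow> 'a) module" where
  "matrix_module R d e \<equiv> free_module R ({..<d} \<times> {..<e})"

definition row_mult ::
    "('a, 'm) ring_scheme \<Rightarrow> nat \<Rightarrow> nat \<Rightarrow> (nat \<Rightarrow> 'a) \<Rightarrow> (nat \<times> nat \<Rightarrow> 'a) \<Rightarrow> nat \<Rightarrow> 'a" where
  "row_mult R d e x a = (\<lambda>j\<in>{..<e}. \<Oplus>\<^bsub>R\<^esub>i\<in>{..<d}. x i \<otimes>\<^bsub>R\<^esub> a (i, j))"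

definition row_kernel ::
    "('a, 'm) ring_scheme \<Rightarrow> nat \<Rightarrow> nat \<Rightarrow> (nat \<times> nat \<Rightarrow> 'a) \<Rightarrow> (nat \<Rightarrow> 'a) set" where
  "row_kernel R d e a = {x \<in> carrier (row_module R d). row_mult R d e x a = \<zero>\<^bsub>row_module R e\<^esub>}"

definition reduce :: "('a, 'm) ring_scheme \<Rightarrow> 'a set \<Rightarrow> 'i set \<Rightarrow> ('i \<Rightarrow> 'a) \<Rightarrow> 'i \<Rightarrow> 'a set" where
  "reduce R I J f = (\<lambda>j\<in>J. I +>\<^bsub>R\<^esub> f j)"

text \<open>Ask zeta functions\<close>

definition matrices_mod ::
    "('a::field \<Rightarrow> real) \<Rightarrow> nat \<Rightarrow> nat \<Rightarrow> (nat \<times> nat \<Rightarrow> 'a) set \<Rightarrow> nat \<Rightarrow> (nat \<times> nat \<Rightarrow> 'a set) set" where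
  "matrices_mod v d e M n = reduce (val_ring v) (max_ideal_pow v n) ({..<d} \<times> {..<e}) ` M"

definition ask_zeta ::
    "('a::field \<Rightarrow> real) \<Rightarrow> nat \<Rightarrow> nat \<Rightarrow> (nat \<times> nat \<Rightarrow> 'a) set \<Rightarrow> complex fps" where
  "ask_zeta v d e M =
    Abs_fps (\<lambda>n. (\<Sum>a\<in>matrices_mod v d e M n.
                    of_nat (card (row_kernel (val_ring v Quot max_ideal_pow v n) d e a)))
                 / of_nat (card (matrices_mod v d e M n)))"

text \<open>
  Here \<open>V \<otimes> \<OO>/(y)\<close> and \<open>W \<otimes> \<OO>/(y)\<close>, with \<open>\<OO>\<close> the valuation ring, are identified with
  \<open>(\<OO>/(y))\<^sup>d\<close> and \<open>(\<OO>/(y))\<^sup>e\<close>.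
  For \<open>y = 0\<close> the cardinalities may be infinite, in which case \<^const>\<open>card\<close> returns 0; this
  concerns a null set only, on which moreover the factor \<open>\<bar>y\<bar> powr _\<close> of the integrands
  vanishes by the convention \<open>0 powr z = 0\<close>.
\<close>

definition ask_K ::
    "('a::field \<Rightarrow> real) \<Rightarrow> nat \<Rightarrow> nat \<Rightarrow> (nat \<times> nat \<Rightarrow> 'a) \<Rightarrow> 'a \<Rightarrow> nat" where
  "ask_K v d e a y =
    (let R = val_ring v; I = PIdl\<^bsub>R\<^esub> y
     in card (row_kernel (R Quot I) d e (reduce R I ({..<d} \<times> {..<e}) a)))"

definition ask_O ::
    "('a::field \<Rightarrow> real) \<Rightarrow> nat \<Rightarrow> nat \<Rightarrow> (nat \<times> nat \<Rightarrow> 'a) set \<Rightarrow> (nat \<Rightarrow> 'a) \<Rightarrow> 'a \<Rightarrow> nat" where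
  "ask_O v d e M x y =
    (let R = val_ring v; I = PIdl\<^bsub>R\<^esub> y
     in card (reduce R I {..<e} ` (row_mult R d e x ` M)))"

text \<open>
  The normalised Haar measure of a compact group \<open>G\<close> with topology \<open>X\<close>, as a measure on the Borel
  sets. Regularity is not listed: it is automatic for finite Borel measures on compact metrisable
  spaces, the only ones used below.
\<close>

definition haar_measure :: "('g, 'm) monoid_scheme \<Rightarrow> 'g topology \<Rightarrow> 'g measure" where
  "haar_measure G X =
    (THE \<mu>. space \<mu> = carrier G \<and>
            sets \<mu> = sigma_sets (carrier G) {U. openin X U} \<and>
            emeasure \<mu> (carrier G) = 1 \<and>
            (\<forall>g\<in>carrier G. \<forall>A\<in>sets \<mu>. emeasure \<mu> (g <#\<^bsub>G\<^esub> A) = emeasure \<mu> A))"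

definition val_ring_topology :: "('a::field \<Rightarrow> real) \<Rightarrow> 'a topology" where
  "val_ring_topology v =
    subtopology (Metric_space.mtopology UNIV (\<lambda>x y. v (x - y))) (carrier (val_ring v))"

text \<open>
  For a submodule \<open>W\<close> of the free module on a finite index set \<open>J\<close>, the Haar measure of the product
  of \<open>W\<close> and the valuation ring. On \<open>W\<close>, the topology defined by any basis of \<open>W\<close> is the subspace
  topology.
\<close>

definition haar_prod :: "('a::field \<Rightarrow> real) \<Rightarrow> 'i set \<Rightarrow> ('i \<Rightarrow> 'a) set \<Rightarrow> (('i \<Rightarrow> 'a) \<times> 'a) measure" where
  "haar_prod v J W =
    haar_measure
      (add_monoid (free_module (val_ring v) J\<lparr>carrier := W\<rparr>) \<times>\<times> add_monoid (val_ring v))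
      (prod_topology
        (subtopology (product_topology (\<lambda>_. val_ring_topology v) J) W)
        (val_ring_topology v))"

end

theory Submission
  imports Defs "HOL-Probability.Infinite_Product_Measure"
begin

text \<open>
  Write \<open>q\<close> for the residue field size. Both integrands are locally constant away from the null set
  \<open>y = 0\<close>: if \<open>\<bar>y\<bar> = q\<^sup>-\<^sup>n\<close>, then \<open>y\<close> generates \<open>P\<^sup>n\<close>, so \<open>K(a, y)\<close> is the size of the kernel
  of \<open>a\<close> modulo \<open>P\<^sup>n\<close> and depends only on the image of \<open>a\<close> in \<open>M\<^sub>n\<close>, while \<open>O(x, y)\<close> is the size of
  \<open>x M\<^sub>n\<close> and depends only on \<open>x\<close> modulo \<open>P\<^sup>n\<close>. Under Haar measure the layer \<open>\<bar>y\<bar> = q\<^sup>-\<^sup>n\<close> has mass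
  \<open>(1 - 1/q) q\<^sup>-\<^sup>n\<close>, and on it reduction modulo \<open>P\<^sup>n\<close> is uniformly distributed, because the fibres
  are translates of each other. Summing over the layers (\<open>integral_locally_constant\<close>) turns the first
  integral into \<open>(1 - 1/q)\<close> times the sum of \<open>q\<^sup>-\<^sup>n\<^sup>s\<close> times the average of \<open>\<bar>Ker(a)\<bar>\<close> over \<open>M\<^sub>n\<close>, and the
  second one into \<open>(1 - 1/q)\<close> times the sum of \<open>q\<^sup>-\<^sup>n\<^sup>s\<close> times the sum of \<open>1 / \<bar>x M\<^sub>n\<bar>\<close> over all \<open>x\<close>
  modulo \<open>P\<^sup>n\<close>. The two series agree term by term (\<open>average_kernel_size\<close>): count the pairs
  \<open>(x, a)\<close> with \<open>x a = 0\<close> in both orders, and note that for fixed \<open>x\<close> the homomorphism \<open>a \<mapsto> x a\<close> has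
  kernel of size \<open>\<bar>M\<^sub>n\<bar> / \<bar>x M\<^sub>n\<bar>\<close>. Absolute convergence for \<open>Re s > d\<close> comes from \<open>\<bar>Ker(a)\<bar> \<le> q\<^sup>n\<^sup>d\<close>.

  For this to make sense, the Haar measure on \<open>M \<times> \<OO>\<close> must be shown to exist and to be unique. The
  congruence subgroups form a chain of finite-index subgroups that is a basis at the identity, and
  nested cosets have a common point. In any group with such a chain (\<open>group_filtration\<close>), elements
  correspond to sequences of digits, and the product of the uniform measures on the digits is
  transported to a measure giving all cosets of the same subgroup the same mass. This forces
  invariance, and conversely invariance forces these masses (\<open>invariant_prob_haar_measure\<close>). That
  nested cosets in \<open>M \<times> \<OO>\<close> meet uses completeness of the field and that a submodule of a free
  module of finite rank is closed (\<open>submodule_closed_if_supported\<close>).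
\<close>

section \<open>Cosets and invariant probability measures\<close>

lemma card_image_eq_if_same_fibres:
  assumes "\<And>a b. a \<in> C \<Longrightarrow> b \<in> C \<Longrightarrow> f a = f b \<longleftrightarrow> g a = g b"
  shows "card (f ` C) = card (g ` C)" "finite (g ` C) \<Longrightarrow> finite (f ` C)"
proof -
  let ?h = "\<lambda>z. g (inv_into C f z)"
  have h: "?h (f a) = g a" if "a \<in> C" for a
    using assms[OF inv_into_into[of "f a" f C] that] f_inv_into_f[of "f a" f C] that by simp
  have inj: "inj_on ?h (f ` C)" using h assms by (auto simp: inj_on_def)
  have im: "?h ` f ` C = g ` C" using h by (force simp: image_iff)
  show "card (f ` C) = card (g ` C)" using card_image[OF inj] im by simp
  show "finite (g ` C) \<Longrightarrow> finite (f ` C)" using finite_image_iff[OF inj] im by simp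
qed

definition invariant_prob :: "('g, 'm) monoid_scheme \<Rightarrow> 'g set set \<Rightarrow> 'g measure \<Rightarrow> bool" where
  "invariant_prob G \<Sigma> \<mu> \<longleftrightarrow>
    space \<mu> = carrier G \<and> sets \<mu> = \<Sigma> \<and> emeasure \<mu> (carrier G) = 1 \<and>
    (\<forall>g\<in>carrier G. \<forall>A\<in>sets \<mu>. emeasure \<mu> (g <#\<^bsub>G\<^esub> A) = emeasure \<mu> A)"

context group
begin

lemma mem_l_coset_iff:
  assumes "H \<subseteq> carrier G" "a \<in> carrier G" "x \<in> carrier G"
  shows "x \<in> a <# H \<longleftrightarrow> inv a \<otimes> x \<in> H"
proof
  assume "x \<in> a <# H"
  then obtain h where "h \<in> H" "x = a \<otimes> h" by (auto simp: l_coset_def)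
  then show "inv a \<otimes> x \<in> H" using assms by (auto simp: subset_iff m_assoc[symmetric])
next
  assume "inv a \<otimes> x \<in> H"
  moreover have "x = a \<otimes> (inv a \<otimes> x)" using assms by (simp add: m_assoc[symmetric])
  ultimately show "x \<in> a <# H" unfolding l_coset_def by blast
qed

lemma mem_own_l_coset: "a \<in> carrier G \<Longrightarrow> subgroup H G \<Longrightarrow> a \<in> a <# H"
  using mem_l_coset_iff[of H a a] subgroup.subset subgroup.one_closed by fastforce

lemma l_coset_eq_iff:
  assumes H: "subgroup H G" and a: "a \<in> carrier G" and b: "b \<in> carrier G"
  shows "a <# H = b <# H \<longleftrightarrow> inv a \<otimes> b \<in> H"
proof
  assume "a <# H = b <# H"
  then have "b \<in> a <# H" using mem_own_l_coset[OF b H] by simp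
  then show "inv a \<otimes> b \<in> H" using mem_l_coset_iff[OF subgroup.subset[OF H] a b] by simp
next
  assume "inv a \<otimes> b \<in> H"
  then have "b \<in> a <# H" using mem_l_coset_iff[OF subgroup.subset[OF H] a b] by simp
  then show "a <# H = b <# H" using l_repr_independence[OF _ a H] by simp
qed

lemma UN_l_cosets:
  assumes H: "subgroup H G"
  shows "\<Union>((\<lambda>a. a <# H) ` carrier G) = carrier G"
proof
  show "\<Union>((\<lambda>a. a <# H) ` carrier G) \<subseteq> carrier G"
    using l_coset_subset_G[OF subgroup.subset[OF H]] by (intro UN_least)
  show "carrier G \<subseteq> \<Union>((\<lambda>a. a <# H) ` carrier G)"
    using mem_own_l_coset[OF _ H] by (intro subsetI UN_I)
qed

lemma l_cosets_disjoint:
  assumes H: "subgroup H G"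
  shows "disjoint ((\<lambda>a. a <# H) ` carrier G)"
proof (rule disjointI)
  fix A B assume "A \<in> (\<lambda>a. a <# H) ` carrier G" "B \<in> (\<lambda>a. a <# H) ` carrier G" "A \<noteq> B"
  then obtain a b where ab: "a \<in> carrier G" "b \<in> carrier G" "A = a <# H" "B = b <# H" by auto
  show "A \<inter> B = {}"
  proof (rule ccontr)
    assume "A \<inter> B \<noteq> {}"
    then obtain x where x: "x \<in> a <# H" "x \<in> b <# H" using ab by auto
    have "a <# H = x <# H" "b <# H = x <# H"
      using l_repr_independence[OF x(1) ab(1) H] l_repr_independence[OF x(2) ab(2) H] .
    then show False using \<open>A \<noteq> B\<close> ab by simp
  qed
qed

text \<open>
  The cosets of a subgroup are finitely many disjoint translates of each other, so they share the
  total mass evenly.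
\<close>

lemma emeasure_l_coset:
  assumes \<mu>: "invariant_prob G \<Sigma> \<mu>" and H: "subgroup H G" "H \<in> \<Sigma>"
    and fin: "finite ((\<lambda>a. a <# H) ` carrier G)"
    and msr: "\<And>a. a \<in> carrier G \<Longrightarrow> a <# H \<in> \<Sigma>"
    and a: "a \<in> carrier G"
  shows "emeasure \<mu> (a <# H) = ennreal (1 / card ((\<lambda>a. a <# H) ` carrier G))"
proof -
  let ?C = "(\<lambda>a. a <# H) ` carrier G"
  have \<mu>': "space \<mu> = carrier G" "sets \<mu> = \<Sigma>" "emeasure \<mu> (carrier G) = 1"
    "\<And>g A. g\<in>carrier G \<Longrightarrow> A\<in>\<Sigma> \<Longrightarrow> emeasure \<mu> (g <# A) = emeasure \<mu> A"
    using \<mu> by (auto simp: invariant_prob_def)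
  have "1 = emeasure \<mu> (\<Union>?C)" using UN_l_cosets[OF H(1)] \<mu>' by simp
  also have "\<dots> = (\<Sum>A\<in>?C. emeasure \<mu> A)"
    using sum_emeasure[of "\<lambda>A. A" ?C \<mu>] msr \<mu>' fin l_cosets_disjoint[OF H(1)]
    by (simp add: image_subset_iff disjoint_image_disjoint_family_on disjoint_family_on_def disjoint_def)
  also have "\<dots> = (\<Sum>A\<in>?C. emeasure \<mu> H)"
    by (intro sum.cong) (auto simp: \<mu>'(4) H)
  also have "\<dots> = of_nat (card ?C) * emeasure \<mu> H" by simp
  finally have eq: "of_nat (card ?C) * emeasure \<mu> H = 1" by simp
  have pos: "card ?C > 0" using fin a by (auto simp: card_gt_0_iff)
  have "emeasure \<mu> H \<noteq> \<infinity>" using eq pos by (auto simp: ennreal_mult_eq_top_iff)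
  then obtain r where r: "emeasure \<mu> H = ennreal r" "r \<ge> 0" by (cases "emeasure \<mu> H") auto
  have "ennreal (real (card ?C) * r) = ennreal 1"
    using eq r by (simp add: ennreal_mult ennreal_of_nat_eq_real_of_nat)
  then have "real (card ?C) * r = 1" using r by (subst (asm) ennreal_inj) auto
  then have "r = 1 / card ?C" using pos by (simp add: field_simps)
  then show ?thesis using r \<mu>'(4)[OF a H(2)] by simp
qed

end

text \<open>
  The fibres of a homomorphism are the cosets of its kernel.
\<close>

lemma (in group_hom) card_carrier_eq_image_times_kernel:
  assumes fin: "finite (carrier G)"
  shows "card (carrier G) = card (h ` carrier G) * card (kernel G H h)"
proof -
  let ?K = "kernel G H h" and ?C = "(\<lambda>a. a <#\<^bsub>G\<^esub> kernel G H h) ` carrier G"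
  have K: "subgroup ?K G" by (rule subgroup_kernel)
  have same: "h a = h b \<longleftrightarrow> a <#\<^bsub>G\<^esub> ?K = b <#\<^bsub>G\<^esub> ?K" if "a \<in> carrier G" "b \<in> carrier G" for a b
  proof -
    have "h (inv\<^bsub>G\<^esub> a \<otimes>\<^bsub>G\<^esub> b) = inv\<^bsub>H\<^esub> (h a) \<otimes>\<^bsub>H\<^esub> h b" using that by simp
    moreover have "inv\<^bsub>H\<^esub> (h a) \<otimes>\<^bsub>H\<^esub> h b = \<one>\<^bsub>H\<^esub> \<longleftrightarrow> h a = h b"
    proof -
      have "\<one>\<^bsub>H\<^esub> = inv\<^bsub>H\<^esub> (h a) \<otimes>\<^bsub>H\<^esub> h b \<longleftrightarrow> h b = h a \<otimes>\<^bsub>H\<^esub> \<one>\<^bsub>H\<^esub>"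
        using that by (intro H.inv_solve_left) simp_all
      moreover have "h a \<otimes>\<^bsub>H\<^esub> \<one>\<^bsub>H\<^esub> = h a" using that by simp
      ultimately show ?thesis by metis
    qed
    ultimately have "h a = h b \<longleftrightarrow> inv\<^bsub>G\<^esub> a \<otimes>\<^bsub>G\<^esub> b \<in> ?K"
      using that by (simp add: kernel_def)
    then show ?thesis using G.l_coset_eq_iff[OF K that] by simp
  qed
  have "card (a <#\<^bsub>G\<^esub> ?K) = card ?K" if a: "a \<in> carrier G" for a
  proof -
    have "a <#\<^bsub>G\<^esub> ?K = (\<lambda>k. a \<otimes>\<^bsub>G\<^esub> k) ` ?K" by (auto simp: l_coset_def)
    moreover have "inj_on (\<lambda>k. a \<otimes>\<^bsub>G\<^esub> k) ?K"
      using a subgroup.subset[OF K] by (auto simp: inj_on_def subset_iff)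
    ultimately show ?thesis by (simp add: card_image)
  qed
  then have "card ?K * card ?C = card (\<Union>?C)"
    using fin disjointD[OF G.l_cosets_disjoint[OF K]]
    by (intro card_partition) (auto simp only: finite_imageI G.UN_l_cosets[OF K])
  moreover have "card (h ` carrier G) = card ?C" by (rule card_image_eq_if_same_fibres(1)[OF same])
  ultimately show ?thesis using G.UN_l_cosets[OF K] by (simp add: mult.commute)
qed

section \<open>The Haar measure of a profinite group\<close>

lemma sigma_sets_insert_empty: "sigma_sets \<Omega> (insert {} A) = sigma_sets \<Omega> A"
  by (intro sigma_sets_eqI) (auto intro: sigma_sets.intros)

text \<open>
  A chain of subgroups as it occurs in a profinite group with a countable basis at the identity. Together
  with the finiteness of the indices, the last assumption amounts to compactness.
\<close>

locale group_filtration = group G for G (structure) +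
  fixes N :: "nat \<Rightarrow> 'a set"
  assumes subgroup_N: "subgroup (N n) G"
    and N_0: "N 0 = carrier G"
    and N_Suc: "N (Suc n) \<subseteq> N n"
    and finite_cosets: "finite ((\<lambda>a. a <# N n) ` carrier G)"
    and complete: "\<lbrakk>\<forall>n. c n \<in> carrier G; \<forall>n. c (Suc n) \<in> c n <# N n\<rbrakk>
      \<Longrightarrow> \<exists>x\<in>carrier G. \<forall>n. x \<in> c n <# N n"
begin

definition cosets :: "'a set set" where
  "cosets = {a <# N n |a n. a \<in> carrier G}"

text \<open>
  Representatives are chosen as functions of the coset, so that congruent elements get equal digits.
  Here \<open>digits n\<close> is a transversal of \<open>N (n + 1)\<close> in \<open>N n\<close>, and an element \<open>x\<close> has the expansion
  \<open>x = c\<^sub>0 c\<^sub>1 c\<^sub>2 ...\<close> in which \<open>remainder x n\<close> is the tail \<open>c\<^sub>n c\<^sub>n\<^sub>+\<^sub>1 ...\<close>.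
\<close>

definition rep :: "nat \<Rightarrow> 'a set \<Rightarrow> 'a" where
  "rep n C = (SOME y. y \<in> N n \<and> y <# N (Suc n) = C)"

definition digits :: "nat \<Rightarrow> 'a set" where
  "digits n = (\<lambda>x. rep n (x <# N (Suc n))) ` N n"

primrec remainder :: "'a \<Rightarrow> nat \<Rightarrow> 'a" where
  "remainder x 0 = x"
| "remainder x (Suc n) = inv (rep n (remainder x n <# N (Suc n))) \<otimes> remainder x n"

definition digit :: "'a \<Rightarrow> nat \<Rightarrow> 'a" where
  "digit x n = rep n (remainder x n <# N (Suc n))"

primrec partial :: "(nat \<Rightarrow> 'a) \<Rightarrow> nat \<Rightarrow> 'a" where
  "partial c 0 = \<one>"
| "partial c (Suc n) = partial c n \<otimes> c n"

lemma N_carrier: "x \<in> N n \<Longrightarrow> x \<in> carrier G"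
  using subgroup.subset[OF subgroup_N] by blast

lemma N_closed:
  "x \<in> N n \<Longrightarrow> y \<in> N n \<Longrightarrow> x \<otimes> y \<in> N n" "x \<in> N n \<Longrightarrow> inv x \<in> N n" "\<one> \<in> N n"
  using subgroup_N[of n] by (auto simp: subgroup_def)

lemma N_antimono: "m \<le> n \<Longrightarrow> N n \<subseteq> N m"
  using lift_Suc_antimono_le[of N] N_Suc by blast

lemma rep:
  assumes "x \<in> N n"
  shows "rep n (x <# N (Suc n)) \<in> N n" "rep n (x <# N (Suc n)) <# N (Suc n) = x <# N (Suc n)"
  using assms someI[of "\<lambda>y. y \<in> N n \<and> y <# N (Suc n) = x <# N (Suc n)" x]
  by (auto simp: rep_def)

lemma digits_N: "c \<in> digits n \<Longrightarrow> c \<in> N n"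
  by (auto simp: digits_def rep)

lemma rep_digits: "c \<in> digits n \<Longrightarrow> rep n (c <# N (Suc n)) = c"
  by (auto simp: digits_def rep)

lemma finite_digits: "finite (digits n)"
proof (rule finite_subset)
  show "digits n \<subseteq> rep n ` (\<lambda>a. a <# N (Suc n)) ` carrier G"
    unfolding digits_def using N_carrier by blast
qed (intro finite_imageI finite_cosets)

lemma digits_nonempty: "digits n \<noteq> {}"
  using N_closed(3) by (auto simp: digits_def)

lemma remainder_N: "x \<in> carrier G \<Longrightarrow> remainder x n \<in> N n"
proof (induction n)
  case (Suc n)
  let ?r = "rep n (remainder x n <# N (Suc n))"
  note r = rep[OF Suc.IH[OF Suc.prems]]
  have "inv ?r \<otimes> remainder x n \<in> N (Suc n)"
    using l_coset_eq_iff[OF subgroup_N N_carrier[OF r(1)] N_carrier[OF Suc.IH[OF Suc.prems]]] r(2) by blast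
  then show ?case by simp
qed (simp add: N_0)

lemma remainder_carrier: "x \<in> carrier G \<Longrightarrow> remainder x n \<in> carrier G"
  using remainder_N N_carrier by blast

lemma digit_digits: "x \<in> carrier G \<Longrightarrow> digit x n \<in> digits n"
  using remainder_N by (auto simp: digit_def digits_def)

lemma digit_carrier: "x \<in> carrier G \<Longrightarrow> digit x n \<in> carrier G"
  using digit_digits digits_N N_carrier by blast

lemma partial_carrier: "(\<And>i. i < n \<Longrightarrow> c i \<in> carrier G) \<Longrightarrow> partial c n \<in> carrier G"
  by (induction n) auto

lemma partial_cong: "(\<And>i. i < n \<Longrightarrow> c i = d i) \<Longrightarrow> partial c n = partial d n"
  by (induction n) auto

lemma partial_remainder: "x \<in> carrier G \<Longrightarrow> partial (digit x) n \<otimes> remainder x n = x"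
proof (induction n)
  case (Suc n)
  have "partial (digit x) (Suc n) \<otimes> remainder x (Suc n)
     = partial (digit x) n \<otimes> (digit x n \<otimes> (inv (digit x n) \<otimes> remainder x n))"
    using digit_carrier[OF Suc.prems] partial_carrier[of n "digit x"] remainder_carrier[OF Suc.prems]
    by (simp add: m_assoc digit_def[symmetric])
  also have "digit x n \<otimes> (inv (digit x n) \<otimes> remainder x n) = remainder x n"
    using digit_carrier[OF Suc.prems] remainder_carrier[OF Suc.prems] by (simp add: m_assoc[symmetric])
  finally show ?case using Suc by simp
qed simp

lemma digit_eq_if_congruent:
  assumes x: "x \<in> carrier G" and y: "y \<in> carrier G" and xy: "inv x \<otimes> y \<in> N n" and "i < n"
  shows "digit x i = digit y i"
proof -
  have eq: "inv (remainder x i) \<otimes> remainder y i = inv x \<otimes> y \<and> (\<forall>j<i. digit x j = digit y j)"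
    if "i \<le> n" for i
    using that
  proof (induction i)
    case (Suc i)
    let ?a = "remainder x i" and ?b = "remainder y i"
    have ab: "?a \<in> carrier G" "?b \<in> carrier G" using remainder_carrier x y by simp_all
    have "inv ?a \<otimes> ?b \<in> N (Suc i)" using Suc xy N_antimono[of "Suc i" n] by auto
    then have *: "digit x i = digit y i"
      using l_coset_eq_iff[OF subgroup_N ab, of "Suc i"] by (simp add: digit_def)
    have d: "digit x i \<in> carrier G" using digit_carrier x by auto
    have "inv (inv (digit x i) \<otimes> ?a) \<otimes> (inv (digit x i) \<otimes> ?b)
        = inv ?a \<otimes> (digit x i \<otimes> inv (digit x i)) \<otimes> ?b"
      using d ab inv_closed by (metis inv_inv inv_mult_group m_assoc m_closed)
    also have "\<dots> = inv ?a \<otimes> ?b" using d ab by simp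
    finally show ?case using Suc * by (auto simp: digit_def less_Suc_eq)
  qed simp
  show ?thesis using eq[of n] \<open>i < n\<close> by auto
qed

text \<open>
  The cosets of \<open>N n\<close> are the cylinders on the first \<open>n\<close> digits.
\<close>

lemma congruent_iff_digit_eq:
  assumes x: "x \<in> carrier G" and y: "y \<in> carrier G"
  shows "inv x \<otimes> y \<in> N n \<longleftrightarrow> (\<forall>i<n. digit x i = digit y i)"
proof
  assume *: "\<forall>i<n. digit x i = digit y i"
  let ?p = "partial (digit x) n"
  have p: "?p \<in> carrier G" using digit_carrier partial_carrier x by auto
  have c: "remainder x n \<in> carrier G" "remainder y n \<in> carrier G" using remainder_carrier x y by simp_all
  have "inv x \<otimes> y = inv (?p \<otimes> remainder x n) \<otimes> (?p \<otimes> remainder y n)"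
    using partial_remainder[OF x, of n] partial_remainder[OF y, of n]
      partial_cong[of n "digit x" "digit y"] * by simp
  also have "\<dots> = inv (remainder x n) \<otimes> (inv ?p \<otimes> ?p) \<otimes> remainder y n"
    using p c inv_closed by (metis inv_mult_group m_assoc m_closed)
  also have "\<dots> = inv (remainder x n) \<otimes> remainder y n" using p c by simp
  finally show "inv x \<otimes> y \<in> N n" using remainder_N x y N_closed by auto
qed (simp add: digit_eq_if_congruent[OF x y])

text \<open>
  Digit sequences may be prescribed freely: a common element of the cosets given by the partial
  products has the prescribed digits.
\<close>

lemma digit_eqI:
  assumes c: "\<And>n. c n \<in> digits n" and x: "x \<in> carrier G"
    and cx: "\<And>n. inv (partial c n) \<otimes> x \<in> N n"
  shows "digit x n = c n"
proof -
  have cc: "c n \<in> carrier G" for n using c digits_N N_carrier by blast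
  have p: "partial c n \<in> carrier G" for n using cc partial_carrier by blast
  have step: "digit x n = c n" if "remainder x n = inv (partial c n) \<otimes> x" for n
  proof -
    have "inv (c n) \<otimes> remainder x n = inv (partial c (Suc n)) \<otimes> x"
      using that cc p x by (simp add: inv_mult_group m_assoc)
    then have "c n <# N (Suc n) = remainder x n <# N (Suc n)"
      using l_coset_eq_iff[OF subgroup_N cc remainder_carrier[OF x]] cx[of "Suc n"] by simp
    then show ?thesis using rep_digits[OF c] by (metis digit_def)
  qed
  have "remainder x n = inv (partial c n) \<otimes> x" for n
  proof (induction n)
    case (Suc n)
    have "remainder x (Suc n) = inv (c n) \<otimes> (inv (partial c n) \<otimes> x)"
      using step[OF Suc] Suc by (simp add: digit_def)
    then show ?case using cc p x by (simp add: inv_mult_group m_assoc)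
  qed (use x in simp)
  then show ?thesis using step by blast
qed

definition expand :: "(nat \<Rightarrow> 'a) \<Rightarrow> 'a" where
  "expand c = (SOME x. x \<in> carrier G \<and> digit x = c)"

lemma expand:
  assumes "c \<in> (\<Pi>\<^sub>E n\<in>UNIV. digits n)"
  shows "expand c \<in> carrier G" "digit (expand c) = c"
proof -
  have c: "c n \<in> digits n" for n using assms by auto
  then have cc: "c n \<in> carrier G" for n using digits_N N_carrier by blast
  have p: "partial c n \<in> carrier G" for n using cc partial_carrier by blast
  have "partial c (Suc n) \<in> partial c n <# N n" for n
    using digits_N[OF c] by (auto simp: l_coset_def)
  then obtain x where x: "x \<in> carrier G" "\<And>n. x \<in> partial c n <# N n"
    using complete[of "partial c"] p by blast
  then have "digit x = c"
    using digit_eqI[OF c x(1)] mem_l_coset_iff[OF subgroup.subset[OF subgroup_N] p x(1)] by (simp add: fun_eq_iff)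
  then have "expand c \<in> carrier G \<and> digit (expand c) = c"
    unfolding expand_def using x(1) by (intro someI[of "\<lambda>x. x \<in> carrier G \<and> digit x = c" x]) auto
  then show "expand c \<in> carrier G" "digit (expand c) = c" by auto
qed

lemma cosets_Pow: "cosets \<subseteq> Pow (carrier G)"
proof
  fix C assume "C \<in> cosets"
  then obtain a n where "C = a <# N n" "a \<in> carrier G" by (auto simp: cosets_def)
  then show "C \<in> Pow (carrier G)"
    using l_coset_subset_G[OF subgroup.subset[OF subgroup_N[of n]]] by simp
qed

lemma carrier_in_cosets: "carrier G \<in> cosets"
proof -
  have "carrier G = \<one> <# N 0" using lcos_mult_one[of "carrier G"] by (simp add: N_0)
  then show ?thesis unfolding cosets_def using one_closed by blast
qed

text \<open>
  As in any ultrametric space, two balls are disjoint or nested.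
\<close>

lemma coset_Int:
  assumes a: "a \<in> carrier G" and b: "b \<in> carrier G" and "m \<le> n"
  shows "(a <# N m) \<inter> (b <# N n) \<in> {{}, b <# N n}"
proof (cases "(a <# N m) \<inter> (b <# N n) = {}")
  case False
  then obtain x where x: "x \<in> a <# N m" "x \<in> b <# N n" by auto
  have "a <# N m = x <# N m" "b <# N n = x <# N n"
    using l_repr_independence[OF x(1) a subgroup_N] l_repr_independence[OF x(2) b subgroup_N] .
  moreover have "x <# N n \<subseteq> x <# N m" using N_antimono[OF \<open>m \<le> n\<close>] by (auto simp: l_coset_def)
  ultimately show ?thesis by auto
qed simp

lemma Int_stable_cosets: "Int_stable (insert {} cosets)"
proof (rule Int_stableI)
  fix A B assume A: "A \<in> insert {} cosets" and B: "B \<in> insert {} cosets"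
  show "A \<inter> B \<in> insert {} cosets"
  proof (cases "A = {} \<or> B = {}")
    case False
    then obtain a m b n where "A = a <# N m" "a \<in> carrier G" "B = b <# N n" "b \<in> carrier G"
      using A B by (auto simp: cosets_def)
    then have "A \<inter> B \<in> {{}, A, B}"
      using coset_Int[of a b m n] coset_Int[of b a n m] by (cases "m \<le> n") (auto simp: Int_commute)
    then have "A \<inter> B = {} \<or> A \<inter> B = A \<or> A \<inter> B = B" by simp
    then show ?thesis using A B by (elim disjE) (simp_all only: insertI1)
  qed auto
qed

lemma measure_eqI_cosets:
  assumes "space \<mu> = carrier G" "sets \<mu> = sigma_sets (carrier G) cosets"
    and "space \<nu> = carrier G" "sets \<nu> = sigma_sets (carrier G) cosets"
    and eq: "\<And>a n. a \<in> carrier G \<Longrightarrow> emeasure \<mu> (a <# N n) = emeasure \<nu> (a <# N n)"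
    and fin: "emeasure \<mu> (carrier G) \<noteq> \<infinity>"
  shows "\<mu> = \<nu>"
proof (rule measure_eqI_generator_eq[where A = "\<lambda>_. carrier G"])
  show "Int_stable (insert {} cosets)" by (rule Int_stable_cosets)
  show "insert {} cosets \<subseteq> Pow (carrier G)" using cosets_Pow by auto
  show "emeasure \<mu> X = emeasure \<nu> X" if "X \<in> insert {} cosets" for X
    using that eq by (auto simp: cosets_def)
  show "range (\<lambda>_::nat. carrier G) \<subseteq> insert {} cosets" using carrier_in_cosets by auto
  show "sets \<mu> = sigma_sets (carrier G) (insert {} cosets)" "sets \<nu> = sigma_sets (carrier G) (insert {} cosets)"
    using assms(2,4) by (simp_all only: sigma_sets_insert_empty)
qed (use fin in auto)

lemma invariant_prob_unique:
  assumes \<mu>: "invariant_prob G (sigma_sets (carrier G) cosets) \<mu>"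
    and \<nu>: "invariant_prob G (sigma_sets (carrier G) cosets) \<nu>"
  shows "\<mu> = \<nu>"
proof (rule measure_eqI_cosets)
  have co: "a <# N n \<in> sigma_sets (carrier G) cosets" if "a \<in> carrier G" for a n
    using that by (auto simp: cosets_def)
  have N: "N n \<in> sigma_sets (carrier G) cosets" for n
    using co[of \<one> n] by (simp add: lcos_mult_one subgroup.subset[OF subgroup_N])
  show "emeasure \<mu> (a <# N n) = emeasure \<nu> (a <# N n)" if "a \<in> carrier G" for a n
    using emeasure_l_coset[OF \<mu> subgroup_N N finite_cosets co that]
      emeasure_l_coset[OF \<nu> subgroup_N N finite_cosets co that] by simp
qed (use \<mu> \<nu> in \<open>auto simp: invariant_prob_def\<close>)

text \<open>
  Push the product of the uniform measures on the digits forward along the expansion map. A coset of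
  \<open>N n\<close> is a cylinder fixing \<open>n\<close> digits, so its mass depends on \<open>n\<close> only.
\<close>

lemma ex_coset_measure:
  "\<exists>\<mu> w. space \<mu> = carrier G \<and> sets \<mu> = sigma_sets (carrier G) cosets \<and>
     emeasure \<mu> (carrier G) = 1 \<and> (\<forall>a\<in>carrier G. \<forall>n. emeasure \<mu> (a <# N n) = w n)"
proof -
  let ?U = "\<lambda>n. uniform_count_measure (digits n)"
  let ?P = "Pi\<^sub>M UNIV ?U"
  let ?S = "sigma (carrier G) cosets"
  have U: "prob_space (?U n)" for n
    using prob_space_uniform_count_measure[OF finite_digits digits_nonempty] .
  interpret P: prob_space ?P by (rule prob_space_PiM[OF U])
  have sp: "space ?P = (\<Pi>\<^sub>E n\<in>UNIV. digits n)"
    by (simp add: space_PiM space_uniform_count_measure)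
  have S: "space ?S = carrier G" "sets ?S = sigma_sets (carrier G) cosets"
    using cosets_Pow by (auto simp: space_measure_of sets_measure_of)
  have vim: "expand -` (a <# N n) \<inter> space ?P
      = prod_emb UNIV ?U {..<n} (\<Pi>\<^sub>E i\<in>{..<n}. {digit a i})" if a: "a \<in> carrier G" for a n
  proof -
    have "expand c \<in> a <# N n \<longleftrightarrow> (\<forall>i<n. c i = digit a i)" if "c \<in> (\<Pi>\<^sub>E n\<in>UNIV. digits n)" for c
      using mem_l_coset_iff[OF subgroup.subset[OF subgroup_N] a expand(1)[OF that], of n]
        congruent_iff_digit_eq[OF a expand(1)[OF that], of n] expand(2)[OF that] by metis
    then show ?thesis
      unfolding sp by (auto simp: prod_emb_def space_uniform_count_measure PiE_iff)
  qed
  have emb: "prod_emb UNIV ?U {..<n} (\<Pi>\<^sub>E i\<in>{..<n}. {digit a i}) \<in> sets ?P"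
    if "a \<in> carrier G" for a n
    using digit_digits[OF that] by (intro sets_PiM_I) (auto simp: sets_uniform_count_measure)
  have meas: "expand \<in> measurable ?P ?S"
  proof (rule measurable_measure_of)
    show "expand \<in> space ?P \<rightarrow> carrier G" using expand(1) sp by auto
    show "expand -` A \<inter> space ?P \<in> sets ?P" if "A \<in> cosets" for A
      using that emb vim unfolding cosets_def by fastforce
  qed (rule cosets_Pow)
  let ?\<mu> = "distr ?P ?S expand"
  have "emeasure ?\<mu> (a <# N n) = (\<Prod>i<n. 1 / of_nat (card (digits i)))" if a: "a \<in> carrier G" for a n
  proof -
    have "a <# N n \<in> sets ?S" using a S by (auto simp: cosets_def)
    then have "emeasure ?\<mu> (a <# N n) = emeasure ?P (expand -` (a <# N n) \<inter> space ?P)"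
      by (rule emeasure_distr[OF meas])
    also have "\<dots> = (\<Prod>i<n. emeasure (?U i) {digit a i})"
      unfolding vim[OF a] using digit_digits[OF a]
      by (intro emeasure_PiM_emb U) (auto simp: sets_uniform_count_measure)
    also have "\<dots> = (\<Prod>i<n. 1 / of_nat (card (digits i)))"
      using digit_digits[OF a] finite_digits
      by (intro prod.cong) (auto simp: emeasure_uniform_count_measure divide_ennreal ennreal_of_nat_eq_real_of_nat
            digits_nonempty card_gt_0_iff simp flip: ennreal_1)
    finally show ?thesis .
  qed
  moreover have "emeasure ?\<mu> (carrier G) = 1"
    using prob_space.emeasure_space_1[OF P.prob_space_distr[OF meas]] S by simp
  ultimately show ?thesis
    using S by (intro exI[of _ ?\<mu>]) auto
qed

text \<open>
  A translate of a coset measure again gives all cosets of \<open>N n\<close> equal mass, and a measure is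
  determined by its values on cosets.
\<close>

lemma ex_invariant_prob: "\<exists>\<mu>. invariant_prob G (sigma_sets (carrier G) cosets) \<mu>"
proof -
  obtain \<mu> w where sp: "space \<mu> = carrier G" and se: "sets \<mu> = sigma_sets (carrier G) cosets"
    and one: "emeasure \<mu> (carrier G) = 1"
    and w: "\<And>a n. a \<in> carrier G \<Longrightarrow> emeasure \<mu> (a <# N n) = w n"
    using ex_coset_measure by blast
  have "emeasure \<mu> (g <# A) = emeasure \<mu> A" if g: "g \<in> carrier G" and A: "A \<in> sets \<mu>" for g A
  proof -
    let ?f = "\<lambda>x. inv g \<otimes> x"
    have pre: "?f -` B \<inter> carrier G = g <# B" if "B \<subseteq> carrier G" for B
      using mem_l_coset_iff[OF that g] l_coset_subset_G[OF that g] by auto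
    have gN: "g <# (a <# N n) = (g \<otimes> a) <# N n" if "a \<in> carrier G" for a n
      using lcos_m_assoc[OF subgroup.subset[OF subgroup_N] g that] .
    have meas: "?f \<in> measurable \<mu> \<mu>"
    proof (rule measurable_sigma_sets[OF se cosets_Pow])
      show "?f \<in> space \<mu> \<rightarrow> carrier G" using g sp by auto
      fix B assume "B \<in> cosets"
      then obtain a n where B: "B = a <# N n" "a \<in> carrier G" by (auto simp: cosets_def)
      then have "?f -` B \<inter> space \<mu> = (g \<otimes> a) <# N n"
        using pre[of B] gN[OF B(2)] l_coset_subset_G[OF subgroup.subset[OF subgroup_N] B(2)] sp by simp
      then show "?f -` B \<inter> space \<mu> \<in> sets \<mu>" unfolding se using g B by (auto simp: cosets_def)
    qed
    have "distr \<mu> \<mu> ?f = \<mu>"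
    proof (rule measure_eqI_cosets)
      show "emeasure (distr \<mu> \<mu> ?f) (a <# N n) = emeasure \<mu> (a <# N n)" if a: "a \<in> carrier G" for a n
      proof -
        have "a <# N n \<in> sets \<mu>" unfolding se using a by (auto simp: cosets_def)
        then have "emeasure (distr \<mu> \<mu> ?f) (a <# N n) = emeasure \<mu> (g <# (a <# N n))"
          using pre[of "a <# N n"] l_coset_subset_G[OF subgroup.subset[OF subgroup_N] a] sp
          by (simp add: emeasure_distr[OF meas])
        then show ?thesis using w gN a g by simp
      qed
      have "emeasure (distr \<mu> \<mu> ?f) (carrier G) = emeasure \<mu> (?f -` carrier G \<inter> space \<mu>)"
        using sets.top[of \<mu>] sp by (intro emeasure_distr[OF meas]) simp
      also have "?f -` carrier G \<inter> space \<mu> = carrier G" using g sp by auto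
      finally show "emeasure (distr \<mu> \<mu> ?f) (carrier G) \<noteq> \<infinity>" using one by simp
    qed (use sp se in auto)
    then have "emeasure \<mu> A = emeasure \<mu> (?f -` A \<inter> space \<mu>)"
      using emeasure_distr[OF meas A] by simp
    also have "?f -` A \<inter> space \<mu> = g <# A"
      using pre[of A] sets.sets_into_space[OF A] sp by simp
    finally show ?thesis by simp
  qed
  then show ?thesis using sp se one by (intro exI[of _ \<mu>]) (auto simp: invariant_prob_def)
qed

lemma countable_cosets: "countable cosets"
proof -
  have "cosets = (\<Union>n. (\<lambda>a. a <# N n) ` carrier G)" by (auto simp: cosets_def)
  also have "countable \<dots>"
    by (intro countable_UN countable_finite[OF finite_cosets]) simp
  finally show ?thesis .
qed

lemma union_of_cosets_measurable:
  assumes "U \<subseteq> carrier G" "\<forall>x\<in>U. \<exists>n. x <# N n \<subseteq> U"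
  shows "U \<in> sigma_sets (carrier G) cosets"
proof -
  have "U = \<Union>{C\<in>cosets. C \<subseteq> U}"
  proof
    show "U \<subseteq> \<Union>{C\<in>cosets. C \<subseteq> U}"
    proof
      fix x assume x: "x \<in> U"
      then obtain n where "x \<in> carrier G" "x <# N n \<subseteq> U" using assms by blast
      moreover from this have "x <# N n \<in> cosets" unfolding cosets_def by blast
      ultimately show "x \<in> \<Union>{C\<in>cosets. C \<subseteq> U}"
        using mem_own_l_coset[OF _ subgroup_N] by (intro UnionI[of "x <# N n"]) simp_all
    qed
  qed auto
  moreover have "\<Union>{C\<in>cosets. C \<subseteq> U} \<in> sigma_sets (carrier G) cosets"
    by (intro sigma_sets_UNION countable_subset[OF _ countable_cosets]) auto
  ultimately show ?thesis by simp
qed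

text \<open>
  Open sets are unions of cosets, of which there are only countably many.
\<close>

lemma sigma_sets_open:
  assumes "\<And>U. openin X U \<longleftrightarrow> U \<subseteq> carrier G \<and> (\<forall>x\<in>U. \<exists>n. x <# N n \<subseteq> U)"
  shows "sigma_sets (carrier G) {U. openin X U} = sigma_sets (carrier G) cosets"
proof (rule sigma_sets_eqI)
  fix U assume "U \<in> {U. openin X U}"
  then show "U \<in> sigma_sets (carrier G) cosets"
    using union_of_cosets_measurable[of U] assms by simp
next
  fix C assume "C \<in> cosets"
  then obtain a n where C: "C = a <# N n" "a \<in> carrier G" by (auto simp: cosets_def)
  have "x <# N n \<subseteq> C" if "x \<in> C" for x
    using l_repr_independence[OF _ C(2) subgroup_N, of x n] that C(1) by simp
  then have "openin X C"
    using l_coset_subset_G[OF subgroup.subset[OF subgroup_N] C(2)] C(1) unfolding assms by auto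
  then show "C \<in> sigma_sets (carrier G) {U. openin X U}" by auto
qed

theorem invariant_prob_haar_measure:
  assumes "\<And>U. openin X U \<longleftrightarrow> U \<subseteq> carrier G \<and> (\<forall>x\<in>U. \<exists>n. x <# N n \<subseteq> U)"
  shows "invariant_prob G (sigma_sets (carrier G) cosets) (haar_measure G X)"
proof -
  have "haar_measure G X = (THE \<mu>. invariant_prob G (sigma_sets (carrier G) cosets) \<mu>)"
    unfolding haar_measure_def sigma_sets_open[OF assms] invariant_prob_def ..
  moreover have "\<exists>!\<mu>. invariant_prob G (sigma_sets (carrier G) cosets) \<mu>"
    using ex_invariant_prob invariant_prob_unique by blast
  ultimately show ?thesis by (metis theI')
qed

end

section \<open>Free modules and matrices over a ring\<close>

lemma carrier_Quot: "carrier (R Quot I) = (\<lambda>x. I +>\<^bsub>R\<^esub> x) ` carrier R"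
  by (auto simp: FactRing_def A_RCOSETS_def')

lemma module_free_module:
  assumes "cring S"
  shows "module S (free_module S J)"
proof -
  interpret cring S by fact
  show ?thesis
  proof (rule moduleI)
    show "abelian_group (free_module S J)"
    proof (rule abelian_groupI)
      fix f assume f: "f \<in> carrier (free_module S J)"
      then show "\<exists>g\<in>carrier (free_module S J). g \<oplus>\<^bsub>free_module S J\<^esub> f = \<zero>\<^bsub>free_module S J\<^esub>"
        by (intro bexI[of _ "\<lambda>j\<in>J. \<ominus>\<^bsub>S\<^esub> f j"])
           (auto simp: free_module_def PiE_iff l_neg intro!: restrict_ext)
      show "\<zero>\<^bsub>free_module S J\<^esub> \<oplus>\<^bsub>free_module S J\<^esub> f = f"
        using f by (auto simp: free_module_def PiE_iff extensional_def)
    qed (auto simp: free_module_def PiE_iff a_ac intro!: restrict_ext)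
  qed (use assms in \<open>auto simp: free_module_def PiE_iff l_distr r_distr m_assoc extensional_def\<close>)
qed

lemma group_free_module: "cring S \<Longrightarrow> group (add_monoid (free_module S J))"
  by (rule abelian_group.a_group[OF module.axioms(2)[OF module_free_module]])

context cring
begin

lemma row_mult_closed:
  assumes "\<xi> \<in> carrier (row_module R d)" "\<alpha> \<in> carrier (matrix_module R d e)"
  shows "row_mult R d e \<xi> \<alpha> \<in> carrier (row_module R e)"
  using assms by (auto simp: row_mult_def free_module_def PiE_iff intro!: finsum_closed)

lemma row_mult_add:
  assumes \<xi>: "\<xi> \<in> carrier (row_module R d)"
    and \<alpha>: "\<alpha> \<in> carrier (matrix_module R d e)" and \<beta>: "\<beta> \<in> carrier (matrix_module R d e)"
  shows "row_mult R d e \<xi> (\<alpha> \<oplus>\<^bsub>matrix_module R d e\<^esub> \<beta>) =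
    row_mult R d e \<xi> \<alpha> \<oplus>\<^bsub>row_module R e\<^esub> row_mult R d e \<xi> \<beta>"
proof -
  have "(\<Oplus>i\<in>{..<d}. \<xi> i \<otimes> (\<alpha> \<oplus>\<^bsub>matrix_module R d e\<^esub> \<beta>) (i, j)) =
      (\<Oplus>i\<in>{..<d}. \<xi> i \<otimes> \<alpha> (i, j)) \<oplus> (\<Oplus>i\<in>{..<d}. \<xi> i \<otimes> \<beta> (i, j))" if j: "j < e" for j
  proof -
    have c: "\<xi> i \<in> carrier R" "\<alpha> (i, j) \<in> carrier R" "\<beta> (i, j) \<in> carrier R" if "i < d" for i
      using that j \<xi> \<alpha> \<beta> by (auto simp: free_module_def PiE_iff)
    have "(\<Oplus>i\<in>{..<d}. \<xi> i \<otimes> (\<alpha> \<oplus>\<^bsub>matrix_module R d e\<^esub> \<beta>) (i, j)) =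
        (\<Oplus>i\<in>{..<d}. \<xi> i \<otimes> \<alpha> (i, j) \<oplus> \<xi> i \<otimes> \<beta> (i, j))"
      using c j by (intro finsum_cong') (auto simp: free_module_def r_distr)
    also have "\<dots> = (\<Oplus>i\<in>{..<d}. \<xi> i \<otimes> \<alpha> (i, j)) \<oplus> (\<Oplus>i\<in>{..<d}. \<xi> i \<otimes> \<beta> (i, j))"
      using c by (intro finsum_addf) auto
    finally show ?thesis .
  qed
  then show ?thesis
    by (auto simp: row_mult_def free_module_def intro!: restrict_ext)
qed

lemma row_mult_hom:
  assumes "\<xi> \<in> carrier (row_module R d)"
  shows "row_mult R d e \<xi> \<in> hom (add_monoid (matrix_module R d e)) (add_monoid (row_module R e))"
  using row_mult_closed[OF assms] row_mult_add[OF assms] by (intro homI) auto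

lemma card_orbit_kernel:
  assumes \<xi>: "\<xi> \<in> carrier (row_module R d)"
    and A: "subgroup A (add_monoid (matrix_module R d e))" "finite A"
  shows "card A = card (row_mult R d e \<xi> ` A) * card {\<alpha>\<in>A. row_mult R d e \<xi> \<alpha> = \<zero>\<^bsub>row_module R e\<^esub>}"
proof -
  let ?G = "add_monoid (matrix_module R d e)" and ?H = "add_monoid (row_module R e)"
  have G: "group ?G" and H: "group ?H" using group_free_module[OF cring_axioms] by auto
  have "group_hom (?G\<lparr>carrier := A\<rparr>) ?H (row_mult R d e \<xi>)"
    using subgroup.subgroup_is_group[OF A(1) G] H row_mult_hom[OF \<xi>, of e] subgroup.subset[OF A(1)]
    by (intro group_hom.intro group_hom_axioms.intro) (auto simp: hom_def Pi_iff subset_iff)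
  from group_hom.card_carrier_eq_image_times_kernel[OF this] A(2)
  show ?thesis by (simp add: kernel_def)
qed

text \<open>
  Count the pairs \<open>(\<xi>, \<alpha>)\<close> with \<open>\<xi> \<alpha> = 0\<close> first by \<open>\<alpha>\<close> and then by \<open>\<xi>\<close>, where
  \<open>card_orbit_kernel\<close> evaluates the inner count.
\<close>

theorem average_kernel_size:
  assumes fin: "finite (carrier R)"
    and A: "subgroup A (add_monoid (matrix_module R d e))"
  shows "(\<Sum>\<alpha>\<in>A. of_nat (card (row_kernel R d e \<alpha>))) / of_nat (card A) =
    (\<Sum>\<xi>\<in>carrier (row_module R d). 1 / of_nat (card (row_mult R d e \<xi> ` A)) :: 'k::field_char_0)"
proof -
  let ?V = "carrier (row_module R d)" and ?z = "\<zero>\<^bsub>row_module R e\<^esub>"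
  have finV: "finite ?V" using fin by (auto simp: free_module_def intro!: finite_PiE)
  have "finite (carrier (matrix_module R d e))" using fin by (auto simp: free_module_def intro!: finite_PiE)
  then have finA: "finite A" using finite_subset[OF subgroup.subset[OF A]] by simp
  have ne: "card A \<noteq> 0" using finA subgroup.one_closed[OF A] by auto
  have "(\<Sum>\<alpha>\<in>A. of_nat (card (row_kernel R d e \<alpha>))) =
      (\<Sum>\<alpha>\<in>A. \<Sum>\<xi>\<in>?V. if row_mult R d e \<xi> \<alpha> = ?z then 1 else 0 :: 'k)"
    using finV by (simp add: row_kernel_def sum.If_cases Int_def)
  also have "\<dots> = (\<Sum>\<xi>\<in>?V. \<Sum>\<alpha>\<in>A. if row_mult R d e \<xi> \<alpha> = ?z then 1 else 0)" by (rule sum.swap)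
  also have "\<dots> = (\<Sum>\<xi>\<in>?V. of_nat (card {\<alpha>\<in>A. row_mult R d e \<xi> \<alpha> = ?z}))"
    using finA by (simp add: sum.If_cases Int_def)
  also have "\<dots> = (\<Sum>\<xi>\<in>?V. of_nat (card A) * (1 / of_nat (card (row_mult R d e \<xi> ` A))))"
  proof (intro sum.cong refl)
    fix \<xi> assume \<xi>: "\<xi> \<in> ?V"
    from card_orbit_kernel[OF \<xi> A finA] ne
    show "of_nat (card {\<alpha>\<in>A. row_mult R d e \<xi> \<alpha> = ?z}) =
        of_nat (card A) * (1 / of_nat (card (row_mult R d e \<xi> ` A)) :: 'k)"
      by (simp add: field_simps)
  qed
  also have "\<dots> = of_nat (card A) * (\<Sum>\<xi>\<in>?V. 1 / of_nat (card (row_mult R d e \<xi> ` A)))"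
    by (rule sum_distrib_left[symmetric])
  finally show ?thesis using ne by simp
qed

end

context ideal
begin

lemma reduce_row_mult:
  assumes R: "cring R"
    and x: "x \<in> carrier (row_module R d)" and a: "a \<in> carrier (matrix_module R d e)"
  shows "reduce R I {..<e} (row_mult R d e x a) =
    row_mult (R Quot I) d e (reduce R I {..<d} x) (reduce R I ({..<d} \<times> {..<e}) a)"
proof -
  interpret h: ring_hom_cring R "R Quot I" "(+>) I" by (rule rcos_ring_hom_cring[OF R])
  have "I +> (\<Oplus>i\<in>{..<d}. x i \<otimes> a (i, j)) =
      (\<Oplus>\<^bsub>R Quot I\<^esub>i\<in>{..<d}. (I +> x i) \<otimes>\<^bsub>R Quot I\<^esub> (I +> a (i, j)))" if j: "j < e" for j
  proof -
    have c: "x i \<in> carrier R" "a (i, j) \<in> carrier R" if "i < d" for i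
      using that j x a by (auto simp: free_module_def PiE_iff)
    have "I +> (\<Oplus>i\<in>{..<d}. x i \<otimes> a (i, j)) =
        (\<Oplus>\<^bsub>R Quot I\<^esub>i\<in>{..<d}. ((+>) I \<circ> (\<lambda>i. x i \<otimes> a (i, j))) i)"
      using c by (subst h.hom_finsum) auto
    also have "\<dots> = (\<Oplus>\<^bsub>R Quot I\<^esub>i\<in>{..<d}. (I +> x i) \<otimes>\<^bsub>R Quot I\<^esub> (I +> a (i, j)))"
      using c by (intro h.S.finsum_cong') auto
    finally show ?thesis .
  qed
  moreover have "(\<Oplus>\<^bsub>R Quot I\<^esub>i\<in>{..<d}. reduce R I {..<d} x i \<otimes>\<^bsub>R Quot I\<^esub> reduce R I ({..<d} \<times> {..<e}) a (i, j)) =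
      (\<Oplus>\<^bsub>R Quot I\<^esub>i\<in>{..<d}. (I +> x i) \<otimes>\<^bsub>R Quot I\<^esub> (I +> a (i, j)))" if j: "j < e" for j
  proof -
    have c: "x i \<in> carrier R" "a (i, j) \<in> carrier R" if "i < d" for i
      using that j x a by (auto simp: free_module_def PiE_iff)
    show ?thesis using c j by (intro h.S.finsum_cong') (auto simp: reduce_def)
  qed
  ultimately show ?thesis
    by (auto simp: row_mult_def reduce_def intro!: restrict_ext)
qed

lemma subgroup_reduce:
  assumes R: "cring R" and W: "subgroup W (add_monoid (free_module R J))"
  shows "subgroup (reduce R I J ` W) (add_monoid (free_module (R Quot I) J))"
proof -
  interpret h: ring_hom_cring R "R Quot I" "(+>) I" by (rule rcos_ring_hom_cring[OF R])
  have "group_hom (add_monoid (free_module R J)) (add_monoid (free_module (R Quot I) J)) (reduce R I J)"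
    using group_free_module[OF R, of J] group_free_module[OF h.S.cring_axioms, of J]
    by (intro group_hom.intro group_hom_axioms.intro)
       (auto simp: hom_def free_module_def reduce_def Pi_iff PiE_iff intro!: restrict_ext)
  then show ?thesis by (rule group_hom.subgroup_img_is_subgroup[OF _ W])
qed

text \<open>
  Vectors over the quotient ring lift entry by entry.
\<close>

lemma reduce_surj: "reduce R I J ` carrier (free_module R J) = carrier (free_module (R Quot I) J)"
proof -
  have "reduce R I J ` (J \<rightarrow>\<^sub>E carrier R) = (J \<rightarrow>\<^sub>E (\<lambda>x. I +> x) ` carrier R)"
  proof (intro subset_antisym subsetI)
    fix g assume g: "g \<in> J \<rightarrow>\<^sub>E (\<lambda>x. I +> x) ` carrier R"
    then have "\<forall>j\<in>J. \<exists>x\<in>carrier R. g j = I +> x" by (auto simp: PiE_iff)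
    then obtain f where f: "\<forall>j\<in>J. f j \<in> carrier R \<and> g j = I +> f j" by metis
    have "g = reduce R I J (restrict f J)"
      using f g by (intro extensionalityI[of _ J]) (auto simp: reduce_def PiE_iff)
    then show "g \<in> reduce R I J ` (J \<rightarrow>\<^sub>E carrier R)" using f by auto
  qed (auto simp: reduce_def)
  then show ?thesis by (simp add: free_module_def carrier_Quot)
qed

end

section \<open>The valuation ring\<close>

context nonarch_local_field
begin

abbreviation R :: "'a ring" where "R \<equiv> val_ring v"

text \<open>
  The absolute value of a uniformiser, as \<open>uniformizer\<close> shows.
\<close>

abbreviation r :: real where "r \<equiv> 1 / real (residue_size v)"

abbreviation P :: "nat \<Rightarrow> 'a set" where "P \<equiv> max_ideal_pow v"

lemma R_simps [simp]:
  "x \<in> carrier R \<longleftrightarrow> v x \<le> 1" "x \<otimes>\<^bsub>R\<^esub> y = x * y" "x \<oplus>\<^bsub>R\<^esub> y = x + y" "\<one>\<^bsub>R\<^esub> = 1" "\<zero>\<^bsub>R\<^esub> = 0"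
  by (auto simp: val_ring_def)

lemma v_0 [simp]: "v 0 = 0" and v_pos: "x \<noteq> 0 \<Longrightarrow> v x > 0"
  using eq_zero_iff nonneg[of x] by (auto simp: less_le)

lemma v_1 [simp]: "v 1 = 1"
  using mult[of 1 1] v_pos[of 1] by simp

lemma v_minus [simp]: "v (- x) = v x"
proof -
  have "v (- 1) * v (- 1) = 1" using mult[of "-1" "-1"] by simp
  then have "v (- 1) = 1" using nonneg[of "-1"] by (metis abs_of_nonneg abs_square_eq_1 power2_eq_square)
  then show ?thesis using mult[of "-1" x] by simp
qed

lemma v_diff_commute: "v (x - y) = v (y - x)"
  using v_minus[of "x - y"] by simp

lemma v_add_le: "v x \<le> c \<Longrightarrow> v y \<le> c \<Longrightarrow> v (x + y) \<le> c"
  using ultrametric[of x y] by auto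

lemma v_diff_le: "v x \<le> c \<Longrightarrow> v y \<le> c \<Longrightarrow> v (x - y) \<le> c"
  using v_add_le[of x c "- y"] by simp

lemma v_mult_le: "v x \<le> 1 \<Longrightarrow> v y \<le> c \<Longrightarrow> v (x * y) \<le> c"
  using mult_mono[of "v x" 1 "v y" c] nonneg[of y] nonneg[of x] by (simp add: mult)

lemma v_divide: "v (x / y) = v x / v y"
proof (cases "y = 0")
  case False
  then show ?thesis using mult[of "x / y" y] v_pos[of y] by (simp add: field_simps)
qed simp

lemma v_power: "v (x ^ n) = v x ^ n"
  by (induction n) (auto simp: mult)

lemma cring_R: "cring R"
proof (rule cringI)
  show "abelian_group R"
  proof (rule abelian_groupI)
    fix x assume "x \<in> carrier R"
    then show "\<exists>y\<in>carrier R. y \<oplus>\<^bsub>R\<^esub> x = \<zero>\<^bsub>R\<^esub>" by (intro bexI[of _ "- x"]) auto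
  qed (auto simp: v_add_le)
  show "comm_monoid R"
    by (rule comm_monoidI) (auto simp: v_mult_le)
qed (auto simp: algebra_simps)

lemma ring_R: "ring R"
  using cring_R by (simp add: cring_def)

lemma a_inv_R [simp]: "v x \<le> 1 \<Longrightarrow> \<ominus>\<^bsub>R\<^esub> x = - x"
  using abelian_group.minus_equality[OF ring.is_abelian_group[OF ring_R], of "- x" x] by simp

lemma a_minus_R [simp]: "v x \<le> 1 \<Longrightarrow> v y \<le> 1 \<Longrightarrow> x \<ominus>\<^bsub>R\<^esub> y = x - y"
  by (simp add: a_minus_def)

lemma PIdl_R: "y \<noteq> 0 \<Longrightarrow> PIdl\<^bsub>R\<^esub> y = {x. v x \<le> v y}"
proof -
  assume y: "y \<noteq> 0"
  have "v x \<le> v y \<longleftrightarrow> (\<exists>c. v c \<le> 1 \<and> x = c * y)" for x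
  proof
    assume "v x \<le> v y"
    then show "\<exists>c. v c \<le> 1 \<and> x = c * y"
      using y v_pos[OF y] by (intro exI[of _ "x / y"]) (simp add: v_divide)
  qed (use v_mult_le in auto)
  then show ?thesis by (auto simp: cgenideal_def)
qed

text \<open>
  Until the normalisation of the absolute value is brought in, the valuation is described in terms
  of a generator of the maximal ideal.
\<close>

lemma ex_generator: "\<exists>\<pi>. \<pi> \<noteq> 0 \<and> v \<pi> < 1 \<and> (\<forall>x. v x < 1 \<longrightarrow> v x \<le> v \<pi>)"
proof -
  obtain \<pi> where \<pi>: "\<pi> \<noteq> 0" "max_ideal v = PIdl\<^bsub>R\<^esub> \<pi>" using discrete by blast
  then have "v x < 1 \<longleftrightarrow> v x \<le> v \<pi>" for x using PIdl_R by (auto simp: max_ideal_def)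
  then show ?thesis using \<pi> by auto
qed

lemma max_ideal_pow_generator:
  assumes \<pi>: "\<pi> \<noteq> 0" "v \<pi> < 1" "\<And>x. v x < 1 \<Longrightarrow> v x \<le> v \<pi>"
  shows "P n = {x. v x \<le> v \<pi> ^ n}"
proof (induction n)
  case 0
  show ?case by (auto simp: max_ideal_pow_def nat_pow_def ideals_set_def)
next
  case (Suc n)
  have "P (Suc n) = P n \<cdot>\<^bsub>R\<^esub> max_ideal v"
    by (simp add: max_ideal_pow_def nat_pow_def ideals_set_def)
  also have "\<dots> = {x. v x \<le> v \<pi> ^ Suc n}"
  proof (intro Set.set_eqI iffI)
    fix x assume "x \<in> P n \<cdot>\<^bsub>R\<^esub> max_ideal v"
    then show "x \<in> {x. v x \<le> v \<pi> ^ Suc n}"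
    proof (induction rule: ideal_prod.induct)
      case (prod i j)
      then have "v i \<le> v \<pi> ^ n" "v j \<le> v \<pi>" using Suc \<pi>(3) by (auto simp: max_ideal_def)
      then have "v i * v j \<le> v \<pi> ^ n * v \<pi>" using nonneg by (intro mult_mono) auto
      then show ?case by (simp add: mult mult.commute)
    qed (auto simp: v_add_le)
  next
    fix x assume "x \<in> {x. v x \<le> v \<pi> ^ Suc n}"
    then have "x / \<pi> \<in> P n"
      using Suc v_pos[OF \<pi>(1)] by (simp add: v_divide field_simps)
    moreover have "\<pi> \<in> max_ideal v" using \<pi> by (simp add: max_ideal_def)
    ultimately have "(x / \<pi>) \<otimes>\<^bsub>R\<^esub> \<pi> \<in> P n \<cdot>\<^bsub>R\<^esub> max_ideal v" by (rule ideal_prod.prod)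
    then show "x \<in> P n \<cdot>\<^bsub>R\<^esub> max_ideal v" using \<pi>(1) by simp
  qed
  finally show ?case .
qed

lemma uniformizer: "\<exists>\<pi>. \<pi> \<noteq> 0 \<and> v \<pi> = r \<and> r < 1 \<and> (\<forall>x. v x < 1 \<longrightarrow> v x \<le> r)"
proof -
  obtain \<pi> where \<pi>: "\<pi> \<noteq> 0" "v \<pi> < 1" "\<And>x. v x < 1 \<Longrightarrow> v x \<le> v \<pi>"
    using ex_generator by blast
  have "v \<pi> ^ 2 < v \<pi>" using v_pos[OF \<pi>(1)] \<pi>(2) by (simp add: power2_eq_square)
  moreover have "P n = {x. v x \<le> v \<pi> ^ n}" for n
    using \<pi> by (rule max_ideal_pow_generator)
  ultimately have "\<pi> \<in> P 1 - P 2" by simp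
  then have "v \<pi> = r" by (rule normalised)
  then show ?thesis using \<pi> by (intro exI[of _ \<pi>]) auto
qed

lemma r_pos: "r > 0" and r_less_1: "r < 1" and residue_size_gt_1: "residue_size v > 1"
proof -
  obtain \<pi> where \<pi>: "\<pi> \<noteq> 0" "v \<pi> = r" "r < 1" using uniformizer by blast
  show *: "r > 0" "r < 1" using \<pi> v_pos by metis+
  then show "residue_size v > 1" by (cases "residue_size v = 0") (auto simp: field_simps)
qed

lemma max_ideal_pow_eq: "P n = {x. v x \<le> r ^ n}"
  using uniformizer max_ideal_pow_generator by metis

text \<open>
  Divide by the power of the uniformiser just above: the quotient has absolute value in \<open>(r, 1]\<close>,
  and no value lies strictly between \<open>r\<close> and \<open>1\<close>.
\<close>

lemma ex_level: "x \<noteq> 0 \<Longrightarrow> v x \<le> 1 \<Longrightarrow> \<exists>n. v x = r ^ n"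
proof -
  assume x: "x \<noteq> 0" "v x \<le> 1"
  obtain \<pi> where \<pi>: "\<pi> \<noteq> 0" "v \<pi> = r" "\<And>y. v y < 1 \<Longrightarrow> v y \<le> r" using uniformizer by blast
  obtain k where k: "r ^ k < v x"
    using real_arch_pow_inv[OF v_pos[OF x(1)] r_less_1] by blast
  define m where "m = (LEAST k. r ^ k < v x)"
  have m: "r ^ m < v x" "\<And>j. j < m \<Longrightarrow> v x \<le> r ^ j"
    unfolding m_def using LeastI[of "\<lambda>k. r ^ k < v x", OF k] not_less_Least[of _ "\<lambda>k. r ^ k < v x"]
    by (auto simp: not_less)
  have "m \<noteq> 0" using m(1) x(2) by (metis not_less power_0)
  then obtain n where n: "m = Suc n" using not0_implies_Suc by blast
  have le: "v x \<le> r ^ n" using m(2) n by simp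
  have "v (x / \<pi> ^ n) = v x / r ^ n" by (simp add: v_divide v_power \<pi>(2))
  moreover have "v x / r ^ n > r" using m(1) n r_pos by (simp add: field_simps)
  ultimately have "\<not> v (x / \<pi> ^ n) < 1" using \<pi>(3)[of "x / \<pi> ^ n"] by auto
  then have "v x \<ge> r ^ n" using \<open>v (x / \<pi> ^ n) = v x / r ^ n\<close> r_pos by (simp add: field_simps)
  then show ?thesis using le by (intro exI[of _ n]) simp
qed

lemma r_pow_le_iff: "r ^ m \<le> r ^ n \<longleftrightarrow> n \<le> m"
  using power_decreasing_iff[OF r_pos r_less_1] by simp

lemma r_pow_eq_iff: "r ^ m = r ^ n \<longleftrightarrow> m = n"
  using r_pow_le_iff[of m n] r_pow_le_iff[of n m] by (auto simp: order_eq_iff)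

lemma r_pow_le_1: "r ^ n \<le> 1"
  using r_pow_le_iff[of n 0] by simp

lemma PIdl_level: "v y = r ^ n \<Longrightarrow> PIdl\<^bsub>R\<^esub> y = P n"
proof -
  assume *: "v y = r ^ n"
  then have "y \<noteq> 0" using r_pos by (metis eq_zero_iff less_irrefl zero_less_power)
  then show ?thesis using PIdl_R * by (simp add: max_ideal_pow_eq)
qed

text \<open>
  This exhibits \<open>v y = r\<^sup>n\<close> as a difference of two balls, which is how the mass of a layer is found.
\<close>

lemma eq_level_iff: "v y = r ^ n \<longleftrightarrow> v y \<le> r ^ n \<and> \<not> v y \<le> r ^ Suc n"
proof
  assume "v y \<le> r ^ n \<and> \<not> v y \<le> r ^ Suc n"
  moreover from this have "y \<noteq> 0" using r_pos by (metis less_imp_le v_0 zero_less_power)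
  moreover have "v y \<le> 1" using calculation r_pow_le_1[of n] by linarith
  ultimately obtain m where m: "v y = r ^ m" "r ^ m \<le> r ^ n" "\<not> r ^ m \<le> r ^ Suc n" using ex_level by metis
  then have "n \<le> m" "\<not> Suc n \<le> m" using r_pow_le_iff by blast+
  then have "m = n" by simp
  then show "v y = r ^ n" using m by simp
next
  assume "v y = r ^ n"
  then show "v y \<le> r ^ n \<and> \<not> v y \<le> r ^ Suc n" using r_pow_le_iff[of n "Suc n"] by auto
qed

lemma ideal_P: "ideal (P n) R"
proof -
  obtain \<pi> where \<pi>: "\<pi> \<noteq> 0" "v \<pi> = r" using uniformizer by blast
  have "PIdl\<^bsub>R\<^esub> (\<pi> ^ n) = P n" using \<pi> by (intro PIdl_level) (simp add: v_power)
  moreover have "\<pi> ^ n \<in> carrier R" using \<pi> r_pow_le_1 by (simp add: v_power)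
  ultimately show ?thesis using cring.cgenideal_ideal[OF cring_R, of "\<pi> ^ n"] by simp
qed

lemma coset_eq_iff:
  "v x \<le> 1 \<Longrightarrow> v y \<le> 1 \<Longrightarrow> P n +>\<^bsub>R\<^esub> x = P n +>\<^bsub>R\<^esub> y \<longleftrightarrow> v (x - y) \<le> r ^ n"
  using ring.quotient_eq_iff_same_a_r_cos[OF ring_R ideal_P, of x y n] by (simp add: max_ideal_pow_eq)

text \<open>
  If \<open>S\<close> represents the residue field and \<open>T\<close> represents the ring modulo \<open>P\<^sup>n\<close>, then the elements
  \<open>s + \<pi> t\<close> represent it modulo \<open>P\<^sup>n\<^sup>+\<^sup>1\<close>.
\<close>

lemma ex_transversal:
  "\<exists>T. finite T \<and> card T = residue_size v ^ n \<and> (\<forall>t\<in>T. v t \<le> 1) \<and>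
     (\<forall>x. v x \<le> 1 \<longrightarrow> (\<exists>t\<in>T. v (x - t) \<le> r ^ n)) \<and>
     (\<forall>s\<in>T. \<forall>t\<in>T. v (s - t) \<le> r ^ n \<longrightarrow> s = t)"
proof (induction n)
  case 0
  show ?case by (intro exI[of _ "{0}"]) simp
next
  case (Suc n)
  then obtain T where T': "finite T" "card T = residue_size v ^ n" "\<forall>t\<in>T. v t \<le> 1"
    "\<forall>x. v x \<le> 1 \<longrightarrow> (\<exists>t\<in>T. v (x - t) \<le> r ^ n)"
    "\<forall>s\<in>T. \<forall>t\<in>T. v (s - t) \<le> r ^ n \<longrightarrow> s = t" by (elim exE conjE)
  note T = T'(1-3) T'(4,5)[rule_format]
  obtain \<pi> where \<pi>: "\<pi> \<noteq> 0" "v \<pi> = r" "\<And>y. v y < 1 \<Longrightarrow> v y \<le> r" using uniformizer by blast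
  have P1: "max_ideal v = P 1"
    using \<pi>(3) r_less_1 by (auto simp: max_ideal_pow_eq max_ideal_def)
  let ?c = "\<lambda>x. P 1 +>\<^bsub>R\<^esub> x"
  have res: "residue_size v = card (?c ` carrier R)" "finite (?c ` carrier R)"
    using finite_residue_field unfolding residue_size_def carrier_Quot P1 by auto
  define S where "S = inv_into (carrier R) ?c ` ?c ` carrier R"
  have S: "finite S" "card S = residue_size v"
    using res card_image[OF inj_on_inv_into[of "?c ` carrier R" ?c "carrier R"]]
    unfolding S_def by simp_all
  have S1: "v s \<le> 1" if "s \<in> S" for s
    using that inv_into_into[of _ ?c "carrier R"] unfolding S_def by (metis R_simps(1) imageE)
  have S2: "\<exists>s\<in>S. v (x - s) \<le> r" if "v x \<le> 1" for x
  proof -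
    let ?s = "inv_into (carrier R) ?c (?c x)"
    have "?s \<in> S" using that by (auto simp: S_def)
    moreover have "?c ?s = ?c x" using that by (intro f_inv_into_f) auto
    ultimately show ?thesis
      using coset_eq_iff[of x ?s 1] that S1 by (intro bexI[of _ ?s]) auto
  qed
  have S3: "s = t" if st: "s \<in> S" "t \<in> S" and "v (s - t) \<le> r" for s t
  proof -
    have "?c s = ?c t" using coset_eq_iff[of s t 1] that S1 by simp
    moreover obtain a b where ab: "a \<in> ?c ` carrier R" "s = inv_into (carrier R) ?c a"
      "b \<in> ?c ` carrier R" "t = inv_into (carrier R) ?c b" using st unfolding S_def by blast
    moreover have "?c s = a" "?c t = b" using ab f_inv_into_f[of _ ?c "carrier R"] by metis+
    ultimately show ?thesis by simp
  qed
  let ?f = "\<lambda>(s, t). s + \<pi> * t"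
  have eq: "s = s' \<and> t = t'"
    if "s \<in> S" "s' \<in> S" "t \<in> T" "t' \<in> T" "v ((s + \<pi> * t) - (s' + \<pi> * t')) \<le> r ^ Suc n" for s s' t t'
  proof -
    have "v (\<pi> * (t' - t)) \<le> r"
      using v_mult_le[of "t' - t" \<pi> r] v_diff_le[of t' 1 t] T(3) that \<pi>(2) by (simp add: mult.commute)
    moreover have "v ((s + \<pi> * t) - (s' + \<pi> * t')) \<le> r"
      using that(5) r_pow_le_iff[of "Suc n" 1] by simp
    ultimately have "v ((s + \<pi> * t) - (s' + \<pi> * t') + \<pi> * (t' - t)) \<le> r" by (intro v_add_le)
    then have "v (s - s') \<le> r" by (simp add: algebra_simps)
    then have s: "s = s'" using S3 that by blast
    have "(s + \<pi> * t) - (s' + \<pi> * t') = \<pi> * (t - t')" using s by (simp add: algebra_simps)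
    then have "r * v (t - t') \<le> r * r ^ n" using that(5) by (simp only: mult \<pi>(2) power_Suc)
    then have "v (t - t') \<le> r ^ n" using mult_le_cancel_left_pos[OF r_pos] by blast
    then show ?thesis using s T(5) that by blast
  qed
  have inj: "inj_on ?f (S \<times> T)"
    using eq r_pos by (auto simp: inj_on_def)
  show ?case
  proof (intro exI[of _ "?f ` (S \<times> T)"] conjI allI impI ballI)
    show "finite (?f ` (S \<times> T))" using S T by auto
    show "card (?f ` (S \<times> T)) = residue_size v ^ Suc n"
      using card_image[OF inj] S T by (simp add: card_cartesian_product)
    show "v t \<le> 1" if "t \<in> ?f ` (S \<times> T)" for t
      using that S1 T(3) \<pi>(2) r_less_1 by (auto intro!: v_add_le v_mult_le)
    show "\<exists>t\<in>?f ` (S \<times> T). v (x - t) \<le> r ^ Suc n" if x1: "v x \<le> 1" for x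
    proof -
      obtain s where s: "s \<in> S" "v (x - s) \<le> r" using S2[OF x1] by blast
      then have "v ((x - s) / \<pi>) \<le> 1"
        unfolding v_divide \<pi>(2) using divide_le_eq_1_pos[OF r_pos] by blast
      then obtain t where t: "t \<in> T" "v ((x - s) / \<pi> - t) \<le> r ^ n" using T(4) by blast
      have "x - (s + \<pi> * t) = \<pi> * ((x - s) / \<pi> - t)" using \<pi>(1) by (simp add: field_simps)
      then have "v (x - (s + \<pi> * t)) = r * v ((x - s) / \<pi> - t)" by (simp only: mult \<pi>(2))
      also have "\<dots> \<le> r ^ Suc n"
        unfolding power_Suc using t(2) mult_le_cancel_left_pos[OF r_pos] by blast
      finally show ?thesis using s t by (intro bexI[of _ "?f (s, t)"]) auto
    qed
    show "a = b" if "a \<in> ?f ` (S \<times> T)" "b \<in> ?f ` (S \<times> T)" "v (a - b) \<le> r ^ Suc n" for a b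
      using that eq by auto
  qed
qed

lemma card_Quot: "card (carrier (R Quot P n)) = residue_size v ^ n"
  and finite_Quot: "finite (carrier (R Quot P n))"
proof -
  obtain T where T': "finite T" "card T = residue_size v ^ n" "\<forall>t\<in>T. v t \<le> 1"
    "\<forall>x. v x \<le> 1 \<longrightarrow> (\<exists>t\<in>T. v (x - t) \<le> r ^ n)"
    "\<forall>s\<in>T. \<forall>t\<in>T. v (s - t) \<le> r ^ n \<longrightarrow> s = t"
    using ex_transversal[of n] by (elim exE conjE)
  note T = T'(1,2) T'(3-5)[rule_format]
  let ?c = "\<lambda>x. P n +>\<^bsub>R\<^esub> x"
  have "?c x \<in> ?c ` T" if x1: "v x \<le> 1" for x
  proof -
    obtain t where t: "t \<in> T" "v (x - t) \<le> r ^ n" using T(4)[OF x1] by blast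
    then have "?c x = ?c t" using coset_eq_iff[OF x1 T(3)] by blast
    then show ?thesis using t by blast
  qed
  then have eq: "carrier (R Quot P n) = ?c ` T"
    unfolding carrier_Quot using T(3) by auto
  have "inj_on ?c T" using T(3,5) coset_eq_iff by (auto simp: inj_on_def)
  then show "card (carrier (R Quot P n)) = residue_size v ^ n" "finite (carrier (R Quot P n))"
    unfolding eq using T by (auto simp: card_image)
qed

end

section \<open>Completeness, and submodules are closed\<close>

context nonarch_local_field
begin

abbreviation FM :: "'i set \<Rightarrow> ('a, 'i \<Rightarrow> 'a) module" where "FM J \<equiv> free_module R J"

lemma FM_carrier [simp]: "w \<in> carrier (FM J) \<longleftrightarrow> w \<in> extensional J \<and> (\<forall>j\<in>J. v (w j) \<le> 1)"
  by (auto simp: free_module_def PiE_iff)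

lemma small_r_pow: "e > 0 \<Longrightarrow> \<exists>n. r ^ n < e"
  using real_arch_pow_inv[OF _ r_less_1] by blast

lemma v_sub_eq_0: "(\<And>n. v x \<le> r ^ n) \<Longrightarrow> x = 0"
  using small_r_pow[of "v x"] v_pos[of x] by (meson not_less)

lemma Metric_space_v: "Metric_space UNIV (\<lambda>x y. v (x - y))"
proof
  fix x y z
  have "v (x - z) \<le> max (v (x - y)) (v (y - z))" using ultrametric[of "x - y" "y - z"] by simp
  then show "v (x - z) \<le> v (x - y) + v (y - z)" using nonneg[of "x - y"] nonneg[of "y - z"] by linarith
qed (auto simp: nonneg eq_zero_iff v_diff_commute)

lemma v_chain:
  assumes "\<And>n. v (x (Suc n) - x n) \<le> r ^ n" and "n \<le> m"
  shows "v (x m - x n) \<le> r ^ n"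
  using \<open>n \<le> m\<close>
proof (induction m rule: dec_induct)
  case (step m)
  have "v (x (Suc m) - x m) \<le> r ^ n" using assms(1)[of m] r_pow_le_iff[of m n] step by linarith
  then have "v ((x (Suc m) - x m) + (x m - x n)) \<le> r ^ n" using step by (intro v_add_le)
  then show ?case by simp
qed (use r_pos in simp)

text \<open>
  This is the form in which completeness is used: nested balls of radii \<open>r\<^sup>n\<close> have a common point.
\<close>

lemma ex_limit:
  assumes x: "\<And>n. v (x (Suc n) - x n) \<le> r ^ n"
  shows "\<exists>l. \<forall>n. v (l - x n) \<le> r ^ n"
proof -
  interpret Metric_space UNIV "\<lambda>x y. v (x - y)" by (rule Metric_space_v)
  have "MCauchy x"
    unfolding MCauchy_def
  proof (intro conjI allI impI)
    fix e :: real assume "e > 0"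
    then obtain k where k: "r ^ k < e" using small_r_pow by blast
    have "v (x n - x m) < e" if "k \<le> n" "k \<le> m" for n m
    proof -
      have "v ((x n - x k) - (x m - x k)) \<le> r ^ k"
        by (intro v_diff_le[OF v_chain[of x, OF x] v_chain[of x, OF x]] that)
      then show ?thesis using k by simp
    qed
    then show "\<exists>N. \<forall>n n'. N \<le> n \<longrightarrow> N \<le> n' \<longrightarrow> v (x n - x n') < e" by blast
  qed simp
  then obtain l where l: "limitin mtopology x l sequentially"
    using complete unfolding mcomplete_def by blast
  have "v (l - x n) \<le> r ^ n" for n
  proof -
    have "\<exists>N. \<forall>m\<ge>N. v (x m - l) < r ^ n"
      using l r_pos unfolding limit_metric_sequentially by simp
    then obtain N where "\<forall>m\<ge>N. v (x m - l) < r ^ n" by blast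
    then have "v (x (max N n) - l) \<le> r ^ n" by (simp add: less_imp_le)
    moreover have "v (x (max N n) - x n) \<le> r ^ n" using v_chain[of x, OF x] by simp
    ultimately have "v ((x (max N n) - x n) - (x (max N n) - l)) \<le> r ^ n" by (rule v_diff_le[rotated])
    then show ?thesis by simp
  qed
  then show ?thesis by blast
qed

text \<open>
  The induction removes one coordinate \<open>k\<close> from the support. Unless all \<open>k\<close>-th entries vanish on \<open>W\<close>, pick \<open>b\<close> in \<open>W\<close> with
  \<open>v (b k)\<close> maximal; then \<open>b k\<close> divides the \<open>k\<close>-th entry of each element of \<open>W\<close> and of \<open>l\<close>. Subtracting
  multiples of \<open>b\<close> reduces the claim to the submodule of elements vanishing at \<open>k\<close>; this costs
  precision \<open>v (b k)\<close>, a fixed amount.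
\<close>

lemma submodule_closed_if_supported:
  assumes "finite K"
    and "W \<subseteq> carrier (FM J)" "W \<noteq> {}"
    and "\<And>f g c. f \<in> W \<Longrightarrow> g \<in> W \<Longrightarrow> v c \<le> 1 \<Longrightarrow> (\<lambda>j\<in>J. f j + c * g j) \<in> W"
    and "\<And>f j. f \<in> W \<Longrightarrow> j \<in> J - K \<Longrightarrow> f j = 0"
    and "l \<in> extensional J" "\<And>j. j \<in> J - K \<Longrightarrow> l j = 0"
    and "\<And>n. \<exists>w\<in>W. \<forall>j\<in>J. v (l j - w j) \<le> r ^ n"
  shows "l \<in> W"
  using assms
proof (induction K arbitrary: W l rule: finite_induct)
  case empty
  then obtain w where w: "w \<in> W" by blast
  have "w = l"
    using empty w by (intro extensionalityI[of _ J]) (auto simp: subset_iff)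
  then show ?case using w by simp
next
  case (insert k K)
  note W = insert.prems(1) and lin = insert.prems(3) and supp = insert.prems(4)
    and lext = insert.prems(5) and lsupp = insert.prems(6) and app = insert.prems(7)
  show ?case
  proof (cases "k \<in> J \<and> (\<exists>w\<in>W. w k \<noteq> 0)")
    case False
    have wk: "w k = 0" if "w \<in> W" "k \<in> J" for w using that False by blast
    have lk: "l k = 0" if k: "k \<in> J"
    proof (rule v_sub_eq_0)
      fix n
      obtain w where w: "w \<in> W" "\<forall>j\<in>J. v (l j - w j) \<le> r ^ n" using app by blast
      then have "v (l k - w k) \<le> r ^ n" using k by blast
      then show "v (l k) \<le> r ^ n" using wk[OF w(1) k] by simp
    qed
    show ?thesis
    proof (rule insert.IH[OF W insert.prems(2) lin _ lext _ app])
      show "f j = 0" if "f \<in> W" "j \<in> J - K" for f j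
        using that supp[of f j] wk[of f] by (cases "j = k") auto
      show "l j = 0" if "j \<in> J - K" for j
        using that lsupp[of j] lk by (cases "j = k") auto
    qed
  next
    case True
    then have kJ: "k \<in> J" by blast
    have W1: "v (w j) \<le> 1" if "w \<in> W" "j \<in> J" for w j
      using subsetD[OF W that(1)] that(2) by simp
    \<comment> \<open>The smallest exponent gives the largest absolute value.\<close>
    define N where "N = (LEAST n. \<exists>w\<in>W. v (w k) = r ^ n)"
    obtain w1 where "w1 \<in> W" "w1 k \<noteq> 0" using True by blast
    then have "\<exists>n. \<exists>w\<in>W. v (w k) = r ^ n"
      using ex_level[of "w1 k"] W1 kJ by blast
    then have "\<exists>w\<in>W. v (w k) = r ^ N" unfolding N_def by (rule LeastI_ex)
    then obtain b where b: "b \<in> W" "v (b k) = r ^ N" by blast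
    have b1: "v (b j) \<le> 1" if "j \<in> J" for j using W1 b that by blast
    have b0: "b k \<noteq> 0"
      using b(2) zero_less_power[OF r_pos, of N] by (intro notI) (simp only: v_0)
    have max: "v (w k) \<le> r ^ N" if wW: "w \<in> W" for w
    proof (cases "w k = 0")
      case False
      then obtain n where n: "v (w k) = r ^ n" using ex_level W1[OF wW kJ] by blast
      then have "N \<le> n" unfolding N_def using wW by (intro Least_le) blast
      then show ?thesis using n r_pow_le_iff by simp
    qed (use r_pos in simp)
    have lk: "v (l k) \<le> r ^ N"
    proof -
      obtain w where w: "w \<in> W" "\<forall>j\<in>J. v (l j - w j) \<le> r ^ N" using app by blast
      then have "v ((l k - w k) + w k) \<le> r ^ N" using kJ max[OF w(1)] by (intro v_add_le) auto
      then show ?thesis by simp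
    qed
    define proj where "proj w = (\<lambda>j\<in>J. w j - w k / b k * b j)" for w
    have quot: "v (x / b k) \<le> 1" if "v x \<le> r ^ N" for x
      unfolding v_divide b(2) using that divide_le_eq_1_pos[OF zero_less_power[OF r_pos, of N]] by blast
    have projW: "proj w \<in> W" if "w \<in> W" for w
    proof -
      have "(\<lambda>j\<in>J. w j + - (w k / b k) * b j) \<in> W"
        using quot[OF max[OF that]] by (intro lin that b) simp
      moreover have "(\<lambda>j\<in>J. w j + - (w k / b k) * b j) = proj w"
        unfolding proj_def by (intro restrict_ext) simp
      ultimately show ?thesis by (simp only:)
    qed
    let ?W = "{w\<in>W. w k = 0}"
    have "proj l \<in> ?W"
    proof (rule insert.IH)
      show "?W \<subseteq> carrier (FM J)" using W by blast
      show "?W \<noteq> {}" using projW[OF b(1)] kJ b0 by (auto simp: proj_def)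
      show "(\<lambda>j\<in>J. f j + c * g j) \<in> ?W" if "f \<in> ?W" "g \<in> ?W" "v c \<le> 1" for f g c
      proof -
        have "(\<lambda>j\<in>J. f j + c * g j) \<in> W" using that by (intro lin) auto
        moreover have "(\<lambda>j\<in>J. f j + c * g j) k = 0" using that kJ by simp
        ultimately show ?thesis by blast
      qed
      show "f j = 0" if "f \<in> ?W" "j \<in> J - K" for f j
        using that supp by (cases "j = k") auto
      show "proj l \<in> extensional J" by (simp add: proj_def)
      show "proj l j = 0" if "j \<in> J - K" for j
        using that lsupp[of j] supp[OF b(1), of j] b0 by (cases "j = k") (auto simp: proj_def)
      show "\<exists>w\<in>?W. \<forall>j\<in>J. v (proj l j - w j) \<le> r ^ n" for n
      proof -
        \<comment> \<open>The extra \<open>N\<close> compensates for the division by \<open>b k\<close> in the projection.\<close>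
        obtain w where w: "w \<in> W" "\<forall>j\<in>J. v (l j - w j) \<le> r ^ (n + N)" using app by blast
        have "v (proj l j - proj w j) \<le> r ^ n" if j: "j \<in> J" for j
        proof -
          have "v (l k - w k) \<le> r ^ n * r ^ N" using w(2) kJ by (simp add: power_add)
          then have "v ((l k - w k) / b k) \<le> r ^ n"
            unfolding v_divide b(2) using pos_divide_le_eq[OF zero_less_power[OF r_pos]] by blast
          then have "v (b j * ((l k - w k) / b k)) \<le> r ^ n" by (rule v_mult_le[OF b1[OF j]])
          moreover have "v (l j - w j) \<le> r ^ n"
            using w(2) j r_pow_le_iff[of "n + N" n] order_trans by fastforce
          ultimately have "v ((l j - w j) - b j * ((l k - w k) / b k)) \<le> r ^ n" by (rule v_diff_le[rotated])
          moreover have "proj l j - proj w j = (l j - w j) - b j * ((l k - w k) / b k)"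
            using j b0 by (simp add: proj_def field_simps)
          ultimately show ?thesis by simp
        qed
        moreover have "proj w \<in> ?W" using projW[OF w(1)] kJ b0 by (simp add: proj_def)
        ultimately show ?thesis by blast
      qed
    qed
    then have "(\<lambda>j\<in>J. proj l j + l k / b k * b j) \<in> W"
      by (intro lin b quot lk) blast
    also have "(\<lambda>j\<in>J. proj l j + l k / b k * b j) = l"
      using lext by (auto simp: proj_def extensional_def)
    finally show ?thesis .
  qed
qed

end

section \<open>The group of a submodule times the valuation ring\<close>

lemma (in nonarch_local_field) FM_ops [simp]:
  "f \<oplus>\<^bsub>FM J\<^esub> g = (\<lambda>j\<in>J. f j + g j)" "\<zero>\<^bsub>FM J\<^esub> = (\<lambda>j\<in>J. 0)"
  by (auto simp: free_module_def)

text \<open>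
  The group \<open>G\<close> below is the one whose Haar measure is \<open>haar_prod v J W\<close>, and its subgroups \<open>H n n\<close>
  form a filtration. Separate precisions for the two factors are needed because a layer
  \<open>v y = r\<^sup>n\<close> involves \<open>y\<close> modulo \<open>P\<^sup>n\<^sup>+\<^sup>1\<close> but the vector only modulo \<open>P\<^sup>n\<close>.
\<close>

locale submodule_of_free = nonarch_local_field v for v :: "'a::field \<Rightarrow> real" +
  fixes J :: "'i set" and W :: "('i \<Rightarrow> 'a) set"
  assumes finite_J: "finite J" and submodule_W: "submodule W R (FM J)"
begin

definition G :: "(('i \<Rightarrow> 'a) \<times> 'a) monoid" where
  "G = add_monoid (FM J\<lparr>carrier := W\<rparr>) \<times>\<times> add_monoid R"

abbreviation red :: "nat \<Rightarrow> ('i \<Rightarrow> 'a) \<Rightarrow> 'i \<Rightarrow> 'a set" where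
  "red n \<equiv> reduce R (P n) J"

lemma W_carrier: "W \<subseteq> carrier (FM J)"
  using subgroup.subset[OF submodule.axioms(1)[OF submodule_W]] by simp

lemma W_le_1: "w \<in> W \<Longrightarrow> j \<in> J \<Longrightarrow> v (w j) \<le> 1"
  using W_carrier FM_carrier by blast

lemma W_ext: "w \<in> W \<Longrightarrow> w \<in> extensional J"
  using W_carrier FM_carrier by blast

lemma W_zero: "(\<lambda>j\<in>J. 0) \<in> W"
  using subgroup.one_closed[OF submodule.axioms(1)[OF submodule_W]] by (simp add: free_module_def)

lemma W_add: "f \<in> W \<Longrightarrow> g \<in> W \<Longrightarrow> (\<lambda>j\<in>J. f j + g j) \<in> W"
  using subgroup.m_closed[OF submodule.axioms(1)[OF submodule_W], of f g]
  by (simp add: free_module_def)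

lemma W_smult: "f \<in> W \<Longrightarrow> v c \<le> 1 \<Longrightarrow> (\<lambda>j\<in>J. c * f j) \<in> W"
  using submodule.smult_closed[OF submodule_W, of c f] by (simp add: free_module_def)

lemma W_lin:
  assumes "f \<in> W" "g \<in> W" "v c \<le> 1"
  shows "(\<lambda>j\<in>J. f j + c * g j) \<in> W"
proof -
  have "(\<lambda>j\<in>J. f j + (\<lambda>j\<in>J. c * g j) j) \<in> W" using assms by (intro W_add W_smult)
  also have "(\<lambda>j\<in>J. f j + (\<lambda>j\<in>J. c * g j) j) = (\<lambda>j\<in>J. f j + c * g j)" by (intro restrict_ext) simp
  finally show ?thesis .
qed

lemma W_diff:
  assumes "f \<in> W" "g \<in> W"
  shows "(\<lambda>j\<in>J. f j - g j) \<in> W"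
proof -
  have "(\<lambda>j\<in>J. f j + (- 1) * g j) \<in> W" using assms by (intro W_lin) auto
  also have "(\<lambda>j\<in>J. f j + (- 1) * g j) = (\<lambda>j\<in>J. f j - g j)" by (intro restrict_ext) simp
  finally show ?thesis .
qed

lemma W_closed:
  assumes "l \<in> extensional J" "\<And>n. \<exists>w\<in>W. \<forall>j\<in>J. v (l j - w j) \<le> r ^ n"
  shows "l \<in> W"
  using W_zero by (intro submodule_closed_if_supported[OF finite_J W_carrier _ W_lin _ assms(1) _ assms(2)]) auto

lemma group_G: "group G"
proof -
  have "module R (FM J\<lparr>carrier := W\<rparr>)"
    using submodule.submodule_is_module[OF submodule_W module_free_module[OF cring_R]] .
  then have "group (add_monoid (FM J\<lparr>carrier := W\<rparr>))"
    by (intro abelian_group.a_group module.axioms(2))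
  moreover have "group (add_monoid R)"
    by (intro abelian_group.a_group ring.is_abelian_group ring_R)
  ultimately show ?thesis unfolding G_def by (rule DirProd_group)
qed

lemma G_simps [simp]:
  "carrier G = W \<times> carrier R"
  "(w, y) \<otimes>\<^bsub>G\<^esub> (w', y') = (\<lambda>j\<in>J. w j + w' j, y + y')"
  "\<one>\<^bsub>G\<^esub> = (\<lambda>j\<in>J. 0, 0)"
  by (auto simp: G_def)

definition H :: "nat \<Rightarrow> nat \<Rightarrow> (('i \<Rightarrow> 'a) \<times> 'a) set" where
  "H n m = {(w, y). w \<in> W \<and> (\<forall>j\<in>J. v (w j) \<le> r ^ n) \<and> v y \<le> r ^ m}"

lemma r_pow_v_le_1: "v y \<le> r ^ m \<Longrightarrow> v y \<le> 1"
  using r_pow_le_1[of m] by linarith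

lemma H_subset: "H n m \<subseteq> carrier G"
  using r_pow_v_le_1 by (auto simp: H_def)

lemma mem_H_coset_iff:
  assumes "w \<in> W" "v y \<le> 1"
  shows "(w', y') \<in> (w, y) <#\<^bsub>G\<^esub> H n m \<longleftrightarrow>
    w' \<in> W \<and> (\<forall>j\<in>J. v (w' j - w j) \<le> r ^ n) \<and> v y' \<le> 1 \<and> v (y' - y) \<le> r ^ m"
proof
  assume "(w', y') \<in> (w, y) <#\<^bsub>G\<^esub> H n m"
  then obtain u z where "w' = (\<lambda>j\<in>J. w j + u j)" "y' = y + z" "u \<in> W" "\<forall>j\<in>J. v (u j) \<le> r ^ n" "v z \<le> r ^ m"
    by (auto simp: l_coset_def H_def)
  moreover from this have "w' \<in> W" using W_add assms by blast
  ultimately show "w' \<in> W \<and> (\<forall>j\<in>J. v (w' j - w j) \<le> r ^ n) \<and> v y' \<le> 1 \<and> v (y' - y) \<le> r ^ m"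
    using r_pow_v_le_1 assms by (auto intro: v_add_le)
next
  assume *: "w' \<in> W \<and> (\<forall>j\<in>J. v (w' j - w j) \<le> r ^ n) \<and> v y' \<le> 1 \<and> v (y' - y) \<le> r ^ m"
  let ?h = "((\<lambda>j\<in>J. w' j - w j), y' - y)"
  have "?h \<in> H n m"
    using * W_diff[of w' w] assms by (simp add: H_def)
  moreover have "(\<lambda>j\<in>J. w j + (\<lambda>j\<in>J. w' j - w j) j) = w'"
    using * W_ext[of w'] by (intro extensionalityI[of _ J]) simp_all
  then have "(w', y') = (w, y) \<otimes>\<^bsub>G\<^esub> ?h" by simp
  ultimately show "(w', y') \<in> (w, y) <#\<^bsub>G\<^esub> H n m"
    unfolding l_coset_def by (intro UN_I[of ?h]) (simp_all only: singleton_iff)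
qed

lemma subgroup_H: "subgroup (H n m) G"
proof -
  interpret group G by (rule group_G)
  show ?thesis
  proof (rule subgroupI)
    show "H n m \<subseteq> carrier G" by (rule H_subset)
    have "(\<lambda>j\<in>J. 0, 0) \<in> H n m" using W_zero r_pos by (simp add: H_def)
    then show "H n m \<noteq> {}" by blast
    fix p assume p: "p \<in> H n m"
    obtain w y where wy: "p = (w, y)" by (cases p)
    let ?i = "((\<lambda>j\<in>J. (\<lambda>j\<in>J. 0) j - w j), 0 - y)"
    have i: "?i \<in> H n m" using p W_diff[OF W_zero, of w] by (auto simp: H_def wy)
    have "?i \<otimes>\<^bsub>G\<^esub> p = \<one>\<^bsub>G\<^esub>" by (auto simp: wy)
    then have "inv\<^bsub>G\<^esub> p = ?i"
      by (rule inv_equality[OF _ subsetD[OF H_subset p] subsetD[OF H_subset i]])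
    then show "inv\<^bsub>G\<^esub> p \<in> H n m" using i by simp
    fix p' assume p': "p' \<in> H n m"
    obtain w' y' where wy': "p' = (w', y')" by (cases p')
    show "p \<otimes>\<^bsub>G\<^esub> p' \<in> H n m"
      using p p' W_add by (auto simp: H_def wy wy' intro: v_add_le)
  qed
qed

lemma red_eq_iff:
  assumes "f \<in> carrier (FM J)" "g \<in> carrier (FM J)"
  shows "red n f = red n g \<longleftrightarrow> (\<forall>j\<in>J. v (f j - g j) \<le> r ^ n)"
proof -
  have "red n f = red n g \<longleftrightarrow> (\<forall>j\<in>J. P n +>\<^bsub>R\<^esub> f j = P n +>\<^bsub>R\<^esub> g j)"
    unfolding reduce_def by (auto simp: fun_eq_iff restrict_def)
  then show ?thesis using coset_eq_iff assms by simp
qed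

lemma red_PiE: "f \<in> carrier (FM J) \<Longrightarrow> red n f \<in> J \<rightarrow>\<^sub>E carrier (R Quot P n)"
  unfolding carrier_Quot reduce_def by (auto simp: PiE_iff)

lemma finite_red: "finite (red n ` W)"
proof (rule finite_subset)
  show "red n ` W \<subseteq> J \<rightarrow>\<^sub>E carrier (R Quot P n)"
    by (intro image_subsetI red_PiE subsetD[OF W_carrier])
  show "finite (J \<rightarrow>\<^sub>E carrier (R Quot P n))"
    by (intro finite_PiE finite_J finite_Quot)
qed

lemma red_nonempty: "card (red n ` W) > 0"
  using finite_red W_zero by (auto simp: card_gt_0_iff)

lemma H_coset_eq_iff:
  assumes "w \<in> W" "v y \<le> 1" "w' \<in> W" "v y' \<le> 1"
  shows "(w, y) <#\<^bsub>G\<^esub> H n m = (w', y') <#\<^bsub>G\<^esub> H n m \<longleftrightarrow>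
    red n w = red n w' \<and> P m +>\<^bsub>R\<^esub> y = P m +>\<^bsub>R\<^esub> y'"
proof -
  interpret group G by (rule group_G)
  have "(w, y) <#\<^bsub>G\<^esub> H n m = (w', y') <#\<^bsub>G\<^esub> H n m \<longleftrightarrow> (w', y') \<in> (w, y) <#\<^bsub>G\<^esub> H n m"
    using l_coset_eq_iff[OF subgroup_H, of "(w, y)" "(w', y')" n m]
      mem_l_coset_iff[OF H_subset, of "(w, y)" "(w', y')" n m] assms by simp
  then show ?thesis
    using mem_H_coset_iff[OF assms(1,2)] red_eq_iff[of w w' n] coset_eq_iff[OF assms(2,4), of m] assms W_carrier
    by (simp add: v_diff_commute[of "w' _"] v_diff_commute[of y'] subset_iff)
qed

text \<open>
  Assigning to \<open>(w, y)\<close> the pair of residues of \<open>w\<close> and \<open>y\<close> separates exactly the cosets.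
\<close>

lemma H_cosets:
  "finite ((\<lambda>a. a <#\<^bsub>G\<^esub> H n m) ` carrier G)"
  "card ((\<lambda>a. a <#\<^bsub>G\<^esub> H n m) ` carrier G) = card (red n ` W) * residue_size v ^ m"
proof -
  let ?g = "\<lambda>(w, y). (red n w, P m +>\<^bsub>R\<^esub> y)"
  have same: "a <#\<^bsub>G\<^esub> H n m = b <#\<^bsub>G\<^esub> H n m \<longleftrightarrow> ?g a = ?g b"
    if "a \<in> carrier G" "b \<in> carrier G" for a b
  proof -
    obtain w y w' y' where "a = (w, y)" "b = (w', y')" by (cases a, cases b)
    then show ?thesis using that H_coset_eq_iff[of w y w' y' n m] by simp
  qed
  have im: "?g ` carrier G = red n ` W \<times> carrier (R Quot P m)"
    unfolding carrier_Quot G_simps(1) by (auto simp: image_iff) 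
  note c = card_image_eq_if_same_fibres[of "carrier G" "\<lambda>a. a <#\<^bsub>G\<^esub> H n m", OF same]
  show "finite ((\<lambda>a. a <#\<^bsub>G\<^esub> H n m) ` carrier G)"
    by (intro c(2)) (simp_all only: im finite_red finite_Quot finite_cartesian_product)
  show "card ((\<lambda>a. a <#\<^bsub>G\<^esub> H n m) ` carrier G) = card (red n ` W) * residue_size v ^ m"
    using c(1) unfolding im by (simp add: card_cartesian_product card_Quot)
qed

text \<open>
  Nested cosets meet because their centres converge in each coordinate, and the limit lies in \<open>W\<close>
  since submodules are closed.
\<close>

lemma filtration: "group_filtration G (\<lambda>n. H n n)"
proof -
  interpret group G by (rule group_G)
  show ?thesis
  proof (intro group_filtration.intro group_filtration_axioms.intro)
    show "H 0 0 = carrier G" using W_le_1 by (auto simp: H_def)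
    show "H (Suc n) (Suc n) \<subseteq> H n n" for n
      using r_pow_le_iff[of "Suc n" n] by (fastforce simp: H_def)
    fix c assume c: "\<forall>n. c n \<in> carrier G" "\<forall>n. c (Suc n) \<in> c n <#\<^bsub>G\<^esub> H n n"
    define w y where "w n = fst (c n)" and "y n = snd (c n)" for n
    have cwy: "c n = (w n, y n)" for n by (simp add: w_def y_def)
    have w: "w n \<in> W" and y: "v (y n) \<le> 1" for n using c(1) unfolding cwy by auto
    have step: "\<forall>j\<in>J. v (w (Suc n) j - w n j) \<le> r ^ n" "v (y (Suc n) - y n) \<le> r ^ n" for n
      using c(2)[rule_format, of n] unfolding cwy mem_H_coset_iff[OF w y] by auto
    have "\<exists>l. \<forall>n. v (l - w n j) \<le> r ^ n" if "j \<in> J" for j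
      using ex_limit[of "\<lambda>n. w n j"] step that by blast
    then obtain L where L: "\<And>j n. j \<in> J \<Longrightarrow> v (L j - w n j) \<le> r ^ n" by metis
    define l where "l = restrict L J"
    obtain z where z: "\<And>n. v (z - y n) \<le> r ^ n" using ex_limit[of y] step by blast
    have l: "\<forall>j\<in>J. v (l j - w n j) \<le> r ^ n" for n using L by (simp add: l_def)
    have lW: "l \<in> W" using l w by (intro W_closed) (auto simp: l_def)
    have z1: "v z \<le> 1" using v_add_le[of "z - y 0" 1 "y 0"] z[of 0] y[of 0] by simp
    show "\<exists>x\<in>carrier G. \<forall>n. x \<in> c n <#\<^bsub>G\<^esub> H n n"
      using lW z1 l z unfolding cwy by (intro bexI[of _ "(l, z)"]) (simp_all add: mem_H_coset_iff[OF w y])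
  qed (rule group_G subgroup_H H_cosets(1))+
qed

lemma openin_val_ring_topology:
  "openin (val_ring_topology v) A \<longleftrightarrow>
    A \<subseteq> carrier R \<and> (\<forall>x\<in>A. \<exists>n. \<forall>y. v (y - x) \<le> r ^ n \<longrightarrow> y \<in> A)"
proof -
  interpret Metric_space UNIV "\<lambda>x y. v (x - y)" by (rule Metric_space_v)
  have top: "openin (val_ring_topology v) A \<longleftrightarrow> A \<subseteq> carrier R \<and> (\<exists>T. openin mtopology T \<and> A = T \<inter> carrier R)"
    unfolding val_ring_topology_def openin_subtopology by blast
  show ?thesis
  proof
    assume "openin (val_ring_topology v) A"
    then obtain T where T: "A \<subseteq> carrier R" "openin mtopology T" "A = T \<inter> carrier R" using top by blast
    have "\<exists>n. \<forall>y. v (y - x) \<le> r ^ n \<longrightarrow> y \<in> A" if x: "x \<in> A" for x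
    proof -
      obtain e where e: "e > 0" "mball x e \<subseteq> T"
        using T x unfolding openin_mtopology by blast
      then obtain n where n: "r ^ n < e" using small_r_pow by blast
      have "y \<in> A" if y: "v (y - x) \<le> r ^ n" for y
      proof -
        have "y \<in> mball x e" using y n by (simp add: v_diff_commute[of x])
        moreover have "v y \<le> 1"
          using v_add_le[of "y - x" 1 x] r_pow_v_le_1[OF y] T(1) x by auto
        ultimately show ?thesis using e(2) T(3) by auto
      qed
      then show ?thesis by blast
    qed
    then show "A \<subseteq> carrier R \<and> (\<forall>x\<in>A. \<exists>n. \<forall>y. v (y - x) \<le> r ^ n \<longrightarrow> y \<in> A)" using T(1) by blast
  next
    assume A: "A \<subseteq> carrier R \<and> (\<forall>x\<in>A. \<exists>n. \<forall>y. v (y - x) \<le> r ^ n \<longrightarrow> y \<in> A)"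
    have "\<exists>e>0. mball x e \<subseteq> A" if "x \<in> A" for x
    proof -
      obtain n where n: "\<forall>y. v (y - x) \<le> r ^ n \<longrightarrow> y \<in> A" using A \<open>x \<in> A\<close> by blast
      have "mball x (r ^ n) \<subseteq> A"
        using n by (auto simp only: in_mball v_diff_commute[of x] intro: less_imp_le)
      then show ?thesis using zero_less_power[OF r_pos] by blast
    qed
    then have "openin mtopology A" unfolding openin_mtopology by blast
    then show "openin (val_ring_topology v) A" using A top by blast
  qed
qed

lemma openin_ball: "v x \<le> 1 \<Longrightarrow> openin (val_ring_topology v) {y. v (y - x) \<le> r ^ n}"
  unfolding openin_val_ring_topology
proof (intro conjI ballI)
  assume x: "v x \<le> 1"
  show "{y. v (y - x) \<le> r ^ n} \<subseteq> carrier R"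
  proof
    fix y assume "y \<in> {y. v (y - x) \<le> r ^ n}"
    then have "v ((y - x) + x) \<le> 1" using r_pow_v_le_1 x by (intro v_add_le) auto
    then show "y \<in> carrier R" by simp
  qed
  fix z assume z: "z \<in> {y. v (y - x) \<le> r ^ n}"
  have "v (y - x) \<le> r ^ n" if "v (y - z) \<le> r ^ n" for y
    using v_add_le[OF that, of "z - x"] z by simp
  then show "\<exists>n'. \<forall>y. v (y - z) \<le> r ^ n' \<longrightarrow> y \<in> {y. v (y - x) \<le> r ^ n}" by blast
qed

text \<open>
  The product topology is the one defined by the filtration. Since \<open>J\<close> is finite, finitely many
  precisions have a common refinement.
\<close>

lemma openin_haar_topology:
  "openin (prod_topology (subtopology (product_topology (\<lambda>_. val_ring_topology v) J) W) (val_ring_topology v)) U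
    \<longleftrightarrow> U \<subseteq> carrier G \<and> (\<forall>p\<in>U. \<exists>n. p <#\<^bsub>G\<^esub> H n n \<subseteq> U)"
    (is "openin (prod_topology ?S ?T) U \<longleftrightarrow> ?rhs")
proof
  have topT: "topspace ?T = carrier R"
    by (simp add: val_ring_topology_def Metric_space.topspace_mtopology[OF Metric_space_v])
  assume U: "openin (prod_topology ?S ?T) U"
  have sub: "U \<subseteq> carrier G" using openin_subset[OF U] by (auto simp: topT)
  have "\<exists>n. p <#\<^bsub>G\<^esub> H n n \<subseteq> U" if pU: "p \<in> U" for p
  proof -
    obtain w y where p: "p = (w, y)" by (cases p)
    have wy: "w \<in> W" "v y \<le> 1" using sub pU p by auto
    obtain A B where A: "openin ?S A" "w \<in> A" and B: "openin ?T B" "y \<in> B" and AB: "A \<times> B \<subseteq> U"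
      using U pU unfolding openin_prod_topology_alt p by blast
    obtain A' where A': "openin (product_topology (\<lambda>_. val_ring_topology v) J) A'" "A = A' \<inter> W"
      using A(1) unfolding openin_subtopology by blast
    have "w \<in> A'" using A(2) A'(2) by simp
    from bspec[OF iffD1[OF openin_product_topology_alt A'(1)] this]
    obtain D where D: "\<forall>j\<in>J. openin ?T (D j)" "w \<in> Pi\<^sub>E J D" "Pi\<^sub>E J D \<subseteq> A'"
      by (elim exE conjE)
    have "\<exists>n. \<forall>x. v (x - w j) \<le> r ^ n \<longrightarrow> x \<in> D j" if "j \<in> J" for j
    proof -
      have "openin ?T (D j)" "w j \<in> D j" using D that by (auto simp: PiE_iff)
      then show ?thesis unfolding openin_val_ring_topology by blast
    qed
    then obtain k where k: "\<And>j x. j \<in> J \<Longrightarrow> v (x - w j) \<le> r ^ k j \<Longrightarrow> x \<in> D j" by metis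
    obtain m where m: "\<And>x. v (x - y) \<le> r ^ m \<Longrightarrow> x \<in> B"
      using B unfolding openin_val_ring_topology by blast
    \<comment> \<open>An upper bound of \<open>m\<close> and all \<open>k j\<close>.\<close>
    define n where "n = m + sum k J"
    have kn: "r ^ n \<le> r ^ k j" if "j \<in> J" for j
      using member_le_sum[OF that, of k] finite_J by (simp add: r_pow_le_iff n_def trans_le_add2)
    have mn: "r ^ n \<le> r ^ m" by (simp add: r_pow_le_iff n_def)
    have "p <#\<^bsub>G\<^esub> H n n \<subseteq> U"
    proof
      fix p' assume p': "p' \<in> p <#\<^bsub>G\<^esub> H n n"
      obtain w' y' where wy': "p' = (w', y')" by (cases p')
      have *: "w' \<in> W" "\<forall>j\<in>J. v (w' j - w j) \<le> r ^ n" "v (y' - y) \<le> r ^ n"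
        using p' unfolding p wy' mem_H_coset_iff[OF wy] by auto
      have "w' j \<in> D j" if "j \<in> J" for j
        using k[OF that] *(2) kn[OF that] that order_trans by blast
      then have "w' \<in> Pi\<^sub>E J D" using W_ext[OF *(1)] by (simp add: PiE_iff)
      then have "w' \<in> A" using D(3) A'(2) *(1) by blast
      moreover have "y' \<in> B" using m *(3) mn order_trans by blast
      ultimately show "p' \<in> U" using AB wy' by blast
    qed
    then show ?thesis by blast
  qed
  then show ?rhs using sub by blast
next
  assume U: ?rhs
  show "openin (prod_topology ?S ?T) U"
    unfolding openin_prod_topology_alt
  proof (intro allI impI)
    fix w y assume wyU: "(w, y) \<in> U"
    then have wy: "w \<in> W" "v y \<le> 1" using U by auto
    obtain n where n: "(w, y) <#\<^bsub>G\<^esub> H n n \<subseteq> U" using U wyU by blast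
    let ?A = "(\<Pi>\<^sub>E j\<in>J. {x. v (x - w j) \<le> r ^ n}) \<inter> W" and ?B = "{x. v (x - y) \<le> r ^ n}"
    have "openin (product_topology (\<lambda>_. ?T) J) (\<Pi>\<^sub>E j\<in>J. {x. v (x - w j) \<le> r ^ n})"
      using openin_ball W_le_1[OF wy(1)] by (simp add: openin_PiE[OF finite_J])
    then have "openin ?S ?A" unfolding openin_subtopology by blast
    moreover have B: "openin ?T ?B" by (rule openin_ball[OF wy(2)])
    moreover have "w \<in> ?A" using wy W_ext[OF wy(1)] r_pos by (auto simp: PiE_iff)
    moreover have "y \<in> ?B" using r_pos by simp
    moreover have "?A \<times> ?B \<subseteq> U"
    proof
      fix p assume p: "p \<in> ?A \<times> ?B"
      obtain w' y' where wy': "p = (w', y')" by (cases p)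
      have "v y' \<le> 1" using B p wy' unfolding openin_val_ring_topology by auto
      then have "p \<in> (w, y) <#\<^bsub>G\<^esub> H n n"
        using p unfolding wy' mem_H_coset_iff[OF wy] by (auto simp: PiE_iff)
      then show "p \<in> U" using n by blast
    qed
    ultimately show "\<exists>A B. openin ?S A \<and> openin ?T B \<and> w \<in> A \<and> y \<in> B \<and> A \<times> B \<subseteq> U" by blast
  qed
qed

sublocale filt: group_filtration G "\<lambda>n. H n n"
  by (rule filtration)

abbreviation \<mu> :: "(('i \<Rightarrow> 'a) \<times> 'a) measure" where "\<mu> \<equiv> haar_prod v J W"

lemma haar_prod_invariant: "invariant_prob G (sigma_sets (carrier G) filt.cosets) \<mu>"
  unfolding haar_prod_def G_def[symmetric] by (rule filt.invariant_prob_haar_measure[OF openin_haar_topology])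

end

section \<open>Integrals of locally constant functions\<close>

context submodule_of_free
begin

lemma space_\<mu>: "space \<mu> = W \<times> carrier R"
  and sets_\<mu>: "sets \<mu> = sigma_sets (carrier G) filt.cosets"
  using haar_prod_invariant by (simp_all add: invariant_prob_def)

lemma prob_space_\<mu>: "prob_space \<mu>"
  using haar_prod_invariant by (intro prob_spaceI) (simp add: invariant_prob_def)

lemma H_coset_sets:
  assumes "a \<in> carrier G"
  shows "a <#\<^bsub>G\<^esub> H n m \<in> sets \<mu>"
proof -
  have "a <#\<^bsub>G\<^esub> H n m \<in> sigma_sets (carrier G) filt.cosets"
  proof (rule filt.union_of_cosets_measurable)
    show "a <#\<^bsub>G\<^esub> H n m \<subseteq> carrier G"
      by (rule filt.l_coset_subset_G[OF H_subset assms])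
    have "x <#\<^bsub>G\<^esub> H (max n m) (max n m) \<subseteq> a <#\<^bsub>G\<^esub> H n m" if x: "x \<in> a <#\<^bsub>G\<^esub> H n m" for x
    proof -
      have "H (max n m) (max n m) \<subseteq> H n m"
        using r_pow_le_iff[of "max n m" n] r_pow_le_iff[of "max n m" m]
        by (fastforce simp: H_def)
      then have "x <#\<^bsub>G\<^esub> H (max n m) (max n m) \<subseteq> x <#\<^bsub>G\<^esub> H n m" by (auto simp: l_coset_def)
      also have "x <#\<^bsub>G\<^esub> H n m = a <#\<^bsub>G\<^esub> H n m"
        using filt.l_repr_independence[OF x assms subgroup_H] by simp
      finally show ?thesis .
    qed
    then show "\<forall>x\<in>a <#\<^bsub>G\<^esub> H n m. \<exists>k. x <#\<^bsub>G\<^esub> H k k \<subseteq> a <#\<^bsub>G\<^esub> H n m" by blast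
  qed
  then show ?thesis by (simp only: sets_\<mu>)
qed

lemma measure_H_coset:
  assumes "a \<in> carrier G"
  shows "measure \<mu> (a <#\<^bsub>G\<^esub> H n m) = r ^ m / card (red n ` W)"
proof -
  have "\<one>\<^bsub>G\<^esub> <#\<^bsub>G\<^esub> H n m = H n m" by (rule filt.lcos_mult_one[OF H_subset])
  then have "H n m \<in> sigma_sets (carrier G) filt.cosets"
    using H_coset_sets[OF filt.one_closed, of n m] sets_\<mu> by simp
  then have "emeasure \<mu> (a <#\<^bsub>G\<^esub> H n m) = ennreal (1 / card ((\<lambda>a. a <#\<^bsub>G\<^esub> H n m) ` carrier G))"
    using H_coset_sets sets_\<mu>
    by (intro filt.emeasure_l_coset[OF haar_prod_invariant subgroup_H _ H_cosets(1) _ assms]) simp_all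
  then have "measure \<mu> (a <#\<^bsub>G\<^esub> H n m) = 1 / card ((\<lambda>a. a <#\<^bsub>G\<^esub> H n m) ` carrier G)"
    by (simp add: measure_def)
  then show ?thesis unfolding H_cosets(2) by (simp add: power_divide)
qed

definition layer :: "nat \<Rightarrow> ('i \<Rightarrow> 'a set) \<Rightarrow> (('i \<Rightarrow> 'a) \<times> 'a) set" where
  "layer n \<xi> = {(w, y). w \<in> W \<and> red n w = \<xi> \<and> v y = r ^ n}"

text \<open>
  The layer is the difference of two nested cosets, of \<open>H n n\<close> and of \<open>H n (n + 1)\<close>.
\<close>

lemma layer_measure:
  assumes "\<xi> \<in> red n ` W"
  shows "layer n \<xi> \<in> sets \<mu>" "measure \<mu> (layer n \<xi>) = (1 - r) * r ^ n / card (red n ` W)"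
proof -
  obtain w where w: "w \<in> W" "\<xi> = red n w" using assms by blast
  let ?C = "\<lambda>m. (w, 0) <#\<^bsub>G\<^esub> H n m"
  have mem: "(w', y') \<in> ?C m \<longleftrightarrow> w' \<in> W \<and> red n w' = \<xi> \<and> v y' \<le> r ^ m" for w' y' m
  proof -
    have "red n w' = \<xi> \<longleftrightarrow> (\<forall>j\<in>J. v (w' j - w j) \<le> r ^ n)" if "w' \<in> W"
      unfolding w(2) using that w(1) W_carrier by (intro red_eq_iff) auto
    then show ?thesis using mem_H_coset_iff[OF w(1), of 0] r_pow_v_le_1 by auto
  qed
  have "p \<in> layer n \<xi> \<longleftrightarrow> p \<in> ?C n - ?C (Suc n)" for p
    by (cases p) (auto simp: layer_def mem eq_level_iff)
  then have eq: "layer n \<xi> = ?C n - ?C (Suc n)" by blast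
  have w0: "(w, 0) \<in> carrier G" using w by simp
  interpret prob_space \<mu> by (rule prob_space_\<mu>)
  show "layer n \<xi> \<in> sets \<mu>" unfolding eq using H_coset_sets[OF w0] by blast
  have "?C (Suc n) \<subseteq> ?C n"
  proof
    fix p assume "p \<in> ?C (Suc n)"
    then show "p \<in> ?C n"
      using r_pow_le_iff[of "Suc n" n] by (cases p) (auto simp: mem intro: order_trans)
  qed
  then have "measure \<mu> (layer n \<xi>) = measure \<mu> (?C n) - measure \<mu> (?C (Suc n))"
    unfolding eq by (intro finite_measure_Diff H_coset_sets[OF w0])
  also have "\<dots> = r ^ n / card (red n ` W) - r * r ^ n / card (red n ` W)"
    unfolding measure_H_coset[OF w0] power_Suc ..
  also have "\<dots> = (1 - r) * r ^ n / card (red n ` W)"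
    by (simp only: diff_divide_distrib[symmetric] left_diff_distrib mult_1)
  finally show "measure \<mu> (layer n \<xi>) = (1 - r) * r ^ n / card (red n ` W)" .
qed

text \<open>
  The function is the sum over \<open>n\<close> of its restrictions to the layers \<open>v y = r\<^sup>n\<close>, each of which is a
  simple function. The summability assumption bounds the sum of their \<open>L\<^sup>1\<close>-norms and permits
  integrating term by term.
\<close>

theorem integral_locally_constant:
  fixes h :: "nat \<Rightarrow> ('i \<Rightarrow> 'a set) \<Rightarrow> complex" and \<Phi> :: "('i \<Rightarrow> 'a) \<times> 'a \<Rightarrow> complex"
  assumes \<Phi>: "\<And>w y n. w \<in> W \<Longrightarrow> v y = r ^ n \<Longrightarrow> \<Phi> (w, y) = h n (red n w)"
    and \<Phi>0: "\<And>w. w \<in> W \<Longrightarrow> \<Phi> (w, 0) = 0"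
    and sum: "summable (\<lambda>n. r ^ n * ((\<Sum>\<xi>\<in>red n ` W. norm (h n \<xi>)) / card (red n ` W)))"
  shows "integrable \<mu> \<Phi>"
    and "(\<lambda>n. of_real ((1 - r) * r ^ n) * ((\<Sum>\<xi>\<in>red n ` W. h n \<xi>) / of_nat (card (red n ` W)))) sums
      integral\<^sup>L \<mu> \<Phi>"
proof -
  interpret prob_space \<mu> by (rule prob_space_\<mu>)
  \<comment> \<open>The restriction of \<open>\<Phi>\<close> to the layer \<open>v y = r\<^sup>n\<close>.\<close>
  define f where "f n p = (\<Sum>\<xi>\<in>red n ` W. indicator (layer n \<xi>) p *\<^sub>R h n \<xi>)" for n p
  have f: "f n (w, y) = (if v y = r ^ n then h n (red n w) else 0)" if w: "w \<in> W" for n w y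
  proof -
    have "f n (w, y) = (\<Sum>\<xi>\<in>red n ` W. if \<xi> = red n w then (if v y = r ^ n then h n \<xi> else 0) else 0)"
      unfolding f_def using w by (intro sum.cong) (auto simp: layer_def indicator_def)
    also have "\<dots> = (if v y = r ^ n then h n (red n w) else 0)"
      using w finite_red[of n] by (simp add: sum.delta)
    finally show ?thesis .
  qed
  have norm_f: "norm (f n p) = (\<Sum>\<xi>\<in>red n ` W. indicator (layer n \<xi>) p *\<^sub>R norm (h n \<xi>))"
    if p: "p \<in> space \<mu>" for n p
  proof -
    obtain w y where wy: "p = (w, y)" "w \<in> W" using p unfolding space_\<mu> by blast
    have "(\<Sum>\<xi>\<in>red n ` W. indicator (layer n \<xi>) p *\<^sub>R norm (h n \<xi>)) =
        (\<Sum>\<xi>\<in>red n ` W. if \<xi> = red n w then (if v y = r ^ n then norm (h n \<xi>) else 0) else 0)"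
      using wy by (intro sum.cong) (auto simp: layer_def indicator_def)
    also have "\<dots> = norm (f n p)"
      using wy finite_red[of n] by (simp add: sum.delta f)
    finally show ?thesis by simp
  qed
  have int1: "integrable \<mu> (\<lambda>p. indicator (layer n \<xi>) p *\<^sub>R c)" if "\<xi> \<in> red n ` W"
    for n \<xi> and c :: "'z::{banach, second_countable_topology}"
    using layer_measure(1)[OF that] by (intro integrable_scaleR_left integrable_real_indicator) (auto simp: emeasure_eq_measure)
  have int2: "(\<integral>p. indicator (layer n \<xi>) p *\<^sub>R c \<partial>\<mu>) = ((1 - r) * r ^ n / card (red n ` W)) *\<^sub>R c"
    if "\<xi> \<in> red n ` W" for n \<xi> and c :: "'z::{banach, second_countable_topology}"
    using layer_measure[OF that] by (simp add: emeasure_eq_measure sets.sets_into_space Int_absorb1)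
  have intf: "integrable \<mu> (f n)" for n
    unfolding f_def using int1 by (intro Bochner_Integration.integrable_sum)
  have integral_f: "integral\<^sup>L \<mu> (f n) =
      of_real ((1 - r) * r ^ n) * ((\<Sum>\<xi>\<in>red n ` W. h n \<xi>) / of_nat (card (red n ` W)))" for n
  proof -
    have "integral\<^sup>L \<mu> (f n) = (\<Sum>\<xi>\<in>red n ` W. \<integral>p. indicator (layer n \<xi>) p *\<^sub>R h n \<xi> \<partial>\<mu>)"
      unfolding f_def using int1 by (intro Bochner_Integration.integral_sum)
    also have "\<dots> = (\<Sum>\<xi>\<in>red n ` W. ((1 - r) * r ^ n / card (red n ` W)) *\<^sub>R h n \<xi>)"
      by (intro sum.cong int2 refl)
    also have "\<dots> = ((1 - r) * r ^ n / card (red n ` W)) *\<^sub>R (\<Sum>\<xi>\<in>red n ` W. h n \<xi>)"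
      by (rule scaleR_sum_right[symmetric])
    finally show ?thesis by (simp add: scaleR_conv_of_real)
  qed
  have integral_norm: "(\<integral>p. norm (f n p) \<partial>\<mu>) =
      (1 - r) * (r ^ n * ((\<Sum>\<xi>\<in>red n ` W. norm (h n \<xi>)) / card (red n ` W)))" for n
  proof -
    have "(\<integral>p. norm (f n p) \<partial>\<mu>) = (\<integral>p. (\<Sum>\<xi>\<in>red n ` W. indicator (layer n \<xi>) p *\<^sub>R norm (h n \<xi>)) \<partial>\<mu>)"
      by (intro Bochner_Integration.integral_cong norm_f refl)
    also have "\<dots> = (\<Sum>\<xi>\<in>red n ` W. \<integral>p. indicator (layer n \<xi>) p *\<^sub>R norm (h n \<xi>) \<partial>\<mu>)"
      using int1 by (intro Bochner_Integration.integral_sum)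
    also have "\<dots> = (\<Sum>\<xi>\<in>red n ` W. ((1 - r) * r ^ n / card (red n ` W)) *\<^sub>R norm (h n \<xi>))"
      by (intro sum.cong int2 refl)
    also have "\<dots> = ((1 - r) * r ^ n / card (red n ` W)) *\<^sub>R (\<Sum>\<xi>\<in>red n ` W. norm (h n \<xi>))"
      by (rule scaleR_sum_right[symmetric])
    finally show ?thesis by simp
  qed
  have sums: "(\<lambda>n. f n p) sums \<Phi> p \<and> summable (\<lambda>n. norm (f n p))" if p: "p \<in> space \<mu>" for p
  proof -
    obtain w y where wy: "p = (w, y)" "w \<in> W" "v y \<le> 1" using p unfolding space_\<mu> by auto
    show ?thesis
    proof (cases "y = 0")
      case True
      have "v 0 \<noteq> r ^ n" for n
        using zero_less_power[OF r_pos, of n] by (intro notI) (simp only: v_0 less_irrefl)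
      then have "f n p = 0" for n unfolding wy(1) True f[OF wy(2)] by (simp only: if_False)
      then show ?thesis using True \<Phi>0[OF wy(2)] wy(1) by simp
    next
      case False
      then obtain N where N: "v y = r ^ N" using ex_level wy by blast
      have fn: "f n p = (if n = N then \<Phi> p else 0)" for n
        using f[OF wy(2), of n y] \<Phi>[OF wy(2) N] r_pow_eq_iff[of N n] unfolding wy(1) N by auto
      have "norm (f n p) = (if n = N then norm (\<Phi> p) else 0)" for n unfolding fn by simp
      then show ?thesis
        using sums_single[of N "\<lambda>_. \<Phi> p"] sums_single[of N "\<lambda>_. norm (\<Phi> p)"]
        unfolding fn by (auto simp: sums_iff)
    qed
  qed
  have sn: "summable (\<lambda>n. \<integral>p. norm (f n p) \<partial>\<mu>)"
    unfolding integral_norm by (rule summable_mult[OF sum])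
  have ae: "AE p in \<mu>. summable (\<lambda>n. norm (f n p))" using sums by (intro AE_I2) blast
  have eq: "\<Phi> p = (\<Sum>n. f n p)" if "p \<in> space \<mu>" for p
    using sums[OF that] by (simp add: sums_iff)
  show "integrable \<mu> \<Phi>"
    using integrable_suminf[OF intf ae sn] eq by (simp cong: Bochner_Integration.integrable_cong)
  have "(\<lambda>n. integral\<^sup>L \<mu> (f n)) sums (\<integral>p. (\<Sum>n. f n p) \<partial>\<mu>)"
    by (rule sums_integral[OF intf ae sn])
  also have "(\<integral>p. (\<Sum>n. f n p) \<partial>\<mu>) = integral\<^sup>L \<mu> \<Phi>"
    using eq by (intro Bochner_Integration.integral_cong) simp_all
  finally show "(\<lambda>n. of_real ((1 - r) * r ^ n) * ((\<Sum>\<xi>\<in>red n ` W. h n \<xi>) / of_nat (card (red n ` W)))) sums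
      integral\<^sup>L \<mu> \<Phi>"
    unfolding integral_f .
qed

end

section \<open>The two integrals\<close>

context nonarch_local_field
begin

lemma cring_Quot: "cring (R Quot P n)"
  using ideal.quotient_is_cring[OF ideal_P cring_R] .

lemma submodule_of_free_carrier: "finite J \<Longrightarrow> submodule_of_free v J (carrier (FM J))"
  by (intro submodule_of_free.intro nonarch_local_field_axioms submodule_of_free_axioms.intro
      module.carrier_is_submodule[OF module_free_module[OF cring_R]])

lemma of_real_r_pow_powr:
  "(of_real (r ^ n) :: complex) powr z = (of_nat (residue_size v) powr (- z)) ^ n"
proof -
  let ?q = "real (residue_size v)"
  have q: "?q > 0" using residue_size_gt_1 by simp
  have "ln (r ^ n) = - (real n * ln ?q)" using q by (simp add: ln_realpow ln_div)
  then have "Ln (of_real (r ^ n)) = - (of_nat n * of_real (ln ?q))"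
    unfolding Ln_of_real[OF zero_less_power[OF r_pos]] by simp
  moreover have "(of_real (r ^ n) :: complex) \<noteq> 0"
    using zero_less_power[OF r_pos, of n] by (simp only: of_real_eq_0_iff)
  ultimately have l: "(of_real (r ^ n) :: complex) powr z = exp (of_nat n * (- z * of_real (ln ?q)))"
    by (simp add: powr_def algebra_simps)
  have "(of_real ?q :: complex) powr (- z) = exp (- z * of_real (ln ?q))"
    using q by (simp only: powr_def Ln_of_real) simp
  then have "(of_nat (residue_size v) :: complex) powr (- z) = exp (- z * of_real (ln ?q))" by simp
  then show ?thesis using l by (simp only: exp_of_nat_mult)
qed

lemma norm_r_pow_powr: "norm ((of_real (r ^ n) :: complex) powr z) = (r ^ n) powr Re z"
  by (subst norm_powr_real_powr) (use zero_less_power[OF r_pos, of n] in auto)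

text \<open>
  Comparison with the geometric series of ratio \<open>r\<^sup>c\<close>.
\<close>

lemma summable_averages:
  fixes h :: "nat \<Rightarrow> 'b \<Rightarrow> complex"
  assumes bound: "\<And>n \<xi>. \<xi> \<in> A n \<Longrightarrow> norm (h n \<xi>) \<le> (r ^ n) powr (c - 1)" and c: "c > 0"
    and fin: "\<And>n. card (A n) > 0"
  shows "summable (\<lambda>n. r ^ n * ((\<Sum>\<xi>\<in>A n. norm (h n \<xi>)) / card (A n)))"
proof (rule summable_comparison_test')
  have "r powr c < 1" using powr_less_mono2[OF c less_imp_le[OF r_pos] r_less_1] by simp
  then show "summable (\<lambda>n. (r powr c) ^ n)" by (intro summable_geometric) simp
  fix n :: nat assume "n \<ge> 0"
  have rn: "r ^ n > 0" by (rule zero_less_power[OF r_pos])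
  have "(\<Sum>\<xi>\<in>A n. norm (h n \<xi>)) \<le> of_nat (card (A n)) * (r ^ n) powr (c - 1)"
    using bound by (intro sum_bounded_above)
  then have "(\<Sum>\<xi>\<in>A n. norm (h n \<xi>)) / card (A n) \<le> (r ^ n) powr (c - 1)"
    using fin[of n] by (simp add: pos_divide_le_eq mult.commute)
  then have "r ^ n * ((\<Sum>\<xi>\<in>A n. norm (h n \<xi>)) / card (A n)) \<le> r ^ n * (r ^ n) powr (c - 1)"
    using rn by (intro mult_left_mono) simp_all
  also have "\<dots> = (r ^ n) powr (1 + (c - 1))" using rn by (simp only: powr_add powr_one)
  also have "\<dots> = (r powr c) ^ n"
    using r_pos by (simp add: powr_powr powr_realpow[symmetric] mult.commute)
  finally show "norm (r ^ n * ((\<Sum>\<xi>\<in>A n. norm (h n \<xi>)) / card (A n))) \<le> (r powr c) ^ n"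
    using rn by (simp add: sum_nonneg)
qed

end

locale ask_zeta_integrals = nonarch_local_field v for v :: "'a::field \<Rightarrow> real" +
  fixes d e :: nat and M :: "(nat \<times> nat \<Rightarrow> 'a) set" and s :: complex
  assumes submodule_M: "submodule M (val_ring v) (matrix_module (val_ring v) d e)"
    and Re_s: "Re s > real d"
begin

abbreviation V :: "(nat \<Rightarrow> 'a) set" where "V \<equiv> carrier (row_module R d)"

sublocale M: submodule_of_free v "{..<d} \<times> {..<e}" M
  by (intro submodule_of_free.intro nonarch_local_field_axioms submodule_of_free_axioms.intro
      finite_cartesian_product finite_lessThan submodule_M)

sublocale V: submodule_of_free v "{..<d}" V
  by (rule submodule_of_free_carrier) simp

abbreviation Q :: "nat \<Rightarrow> 'a set ring" where "Q n \<equiv> R Quot P n"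

abbreviation T :: complex where "T \<equiv> of_nat (residue_size v) powr (- s)"

lemma matrices_mod_eq: "matrices_mod v d e M n = M.red n ` M"
  by (simp add: matrices_mod_def)

lemma V_mod: "V.red n ` V = carrier (row_module (Q n) d)"
  by (rule ideal.reduce_surj[OF ideal_P])

lemma card_V_mod: "card (V.red n ` V) = (residue_size v ^ n) ^ d"
  unfolding V_mod by (simp add: free_module_def card_PiE card_Quot)

lemma subgroup_M_mod: "subgroup (M.red n ` M) (add_monoid (matrix_module (Q n) d e))"
  by (rule ideal.subgroup_reduce[OF ideal_P cring_R submodule.axioms(1)[OF submodule_M]])

lemma card_row_kernel_le: "card (row_kernel (Q n) d e \<alpha>) \<le> (residue_size v ^ n) ^ d"
proof -
  have "card (row_kernel (Q n) d e \<alpha>) \<le> card (V.red n ` V)"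
    using V.finite_red[of n] unfolding V_mod by (intro card_mono) (auto simp: row_kernel_def)
  then show ?thesis unfolding card_V_mod .
qed

text \<open>
  The value of each integrand at level \<open>v y = r\<^sup>n\<close> is expressed through residues modulo \<open>P\<^sup>n\<close> by
  \<open>kernel_value\<close> and \<open>orbit_value\<close>.
\<close>

definition kernel_integrand :: "(nat \<times> nat \<Rightarrow> 'a) \<times> 'a \<Rightarrow> complex" where
  "kernel_integrand = (\<lambda>(a, y). of_real (v y) powr (s - 1) * of_nat (ask_K v d e a y))"

definition orbit_integrand :: "(nat \<Rightarrow> 'a) \<times> 'a \<Rightarrow> complex" where
  "orbit_integrand = (\<lambda>(x, y). of_real (v y) powr (s - of_nat d - 1) / of_nat (ask_O v d e M x y))"

definition kernel_value :: "nat \<Rightarrow> (nat \<times> nat \<Rightarrow> 'a set) \<Rightarrow> complex" where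
  "kernel_value n \<alpha> = of_real (r ^ n) powr (s - 1) * of_nat (card (row_kernel (Q n) d e \<alpha>))"

definition orbit_value :: "nat \<Rightarrow> (nat \<Rightarrow> 'a set) \<Rightarrow> complex" where
  "orbit_value n \<xi> = of_real (r ^ n) powr (s - of_nat d - 1) / of_nat (card (row_mult (Q n) d e \<xi> ` M.red n ` M))"

lemma kernel_integrand_level: "v y = r ^ n \<Longrightarrow> kernel_integrand (a, y) = kernel_value n (M.red n a)"
  by (simp add: kernel_integrand_def kernel_value_def ask_K_def Let_def PIdl_level)

lemma orbit_integrand_level:
  assumes x: "x \<in> V" and y: "v y = r ^ n"
  shows "orbit_integrand (x, y) = orbit_value n (V.red n x)"
proof -
  have "reduce R (P n) {..<e} ` row_mult R d e x ` M = row_mult (Q n) d e (V.red n x) ` M.red n ` M"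
    unfolding image_image
    by (intro image_cong refl ideal.reduce_row_mult[OF ideal_P cring_R x] subsetD[OF M.W_carrier])
  then show ?thesis using y by (simp add: orbit_integrand_def orbit_value_def ask_O_def Let_def PIdl_level)
qed

lemma norm_kernel_value_le: "norm (kernel_value n \<alpha>) \<le> (r ^ n) powr (Re s - real d - 1)"
proof -
  have rn: "r ^ n > 0" by (rule zero_less_power[OF r_pos])
  have "norm (kernel_value n \<alpha>) = (r ^ n) powr (Re s - 1) * real (card (row_kernel (Q n) d e \<alpha>))"
    unfolding kernel_value_def norm_mult norm_r_pow_powr by simp
  also have "\<dots> \<le> (r ^ n) powr (Re s - 1) * real ((residue_size v ^ n) ^ d)"
    using card_row_kernel_le by (intro mult_left_mono) (simp_all only: of_nat_le_iff powr_ge_zero)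
  also have "real ((residue_size v ^ n) ^ d) = (r ^ n) powr (- real d)"
    using rn residue_size_gt_1 by (simp only: powr_minus powr_realpow) (simp add: power_divide)
  also have "(r ^ n) powr (Re s - 1) * (r ^ n) powr (- real d) = (r ^ n) powr (Re s - real d - 1)"
    by (simp only: powr_add[symmetric]) (simp add: algebra_simps)
  finally show ?thesis .
qed

lemma norm_orbit_value_le: "norm (orbit_value n \<xi>) \<le> (r ^ n) powr (Re s - real d - 1)"
proof -
  let ?k = "card (row_mult (Q n) d e \<xi> ` M.red n ` M)"
  have "norm (orbit_value n \<xi>) = (r ^ n) powr (Re s - real d - 1) * (1 / real ?k)"
    unfolding orbit_value_def norm_divide norm_r_pow_powr by simp
  also have "\<dots> \<le> (r ^ n) powr (Re s - real d - 1) * 1"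
    by (intro mult_left_mono) (simp_all add: divide_le_eq)
  finally show ?thesis by simp
qed

lemma r_pow_mult_powr: "of_real (r ^ n) * (of_real (r ^ n) :: complex) powr (z - 1) = of_real (r ^ n) powr z"
proof -
  have "(of_real (r ^ n) :: complex) \<noteq> 0"
    using zero_less_power[OF r_pos, of n] by (simp only: of_real_eq_0_iff)
  then show ?thesis by (simp add: powr_diff)
qed

lemma kernel_coefficient:
  "of_real ((1 - r) * r ^ n) * ((\<Sum>\<alpha>\<in>M.red n ` M. kernel_value n \<alpha>) / of_nat (card (M.red n ` M))) =
    of_real (1 - r) * (fps_nth (ask_zeta v d e M) n * T ^ n)"
proof -
  let ?S = "\<Sum>\<alpha>\<in>M.red n ` M. of_nat (card (row_kernel (Q n) d e \<alpha>)) :: complex"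
  let ?k = "of_nat (card (M.red n ` M)) :: complex"
  have "(\<Sum>\<alpha>\<in>M.red n ` M. kernel_value n \<alpha>) = of_real (r ^ n) powr (s - 1) * ?S"
    unfolding kernel_value_def by (rule sum_distrib_left[symmetric])
  then have "of_real ((1 - r) * r ^ n) * ((\<Sum>\<alpha>\<in>M.red n ` M. kernel_value n \<alpha>) / ?k) =
      of_real (1 - r) * ((of_real (r ^ n) * of_real (r ^ n) powr (s - 1)) * (?S / ?k))"
    by (simp only: of_real_mult times_divide_eq_right mult_ac)
  also have "\<dots> = of_real (1 - r) * (fps_nth (ask_zeta v d e M) n * T ^ n)"
    unfolding r_pow_mult_powr unfolding of_real_r_pow_powr
    by (simp only: ask_zeta_def fps_nth_Abs_fps matrices_mod_eq mult.commute[of "T ^ n"])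
  finally show ?thesis .
qed

text \<open>
  The factor \<open>r\<^sup>n\<^sup>d\<close> from averaging over all vectors modulo \<open>P\<^sup>n\<close> cancels the \<open>d\<close> in the exponent of the
  integrand; what remains is the other side of \<open>average_kernel_size\<close>.
\<close>

lemma orbit_coefficient:
  "of_real ((1 - r) * r ^ n) * ((\<Sum>\<xi>\<in>V.red n ` V. orbit_value n \<xi>) / of_nat (card (V.red n ` V))) =
    of_real (1 - r) * (fps_nth (ask_zeta v d e M) n * T ^ n)"
proof -
  let ?S = "\<Sum>\<xi>\<in>V.red n ` V. 1 / of_nat (card (row_mult (Q n) d e \<xi> ` M.red n ` M)) :: complex"
  have nz: "(of_real (r ^ n) :: complex) \<noteq> 0"
    using zero_less_power[OF r_pos, of n] by (simp only: of_real_eq_0_iff)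
  have rearrange: "a * b * ((c * t) / k) = a * ((b * c) * (1 / k) * t)" for a b c t k :: complex
    by simp
  have "(\<Sum>\<xi>\<in>V.red n ` V. orbit_value n \<xi>) = of_real (r ^ n) powr (s - of_nat d - 1) * ?S"
    unfolding orbit_value_def sum_distrib_left by (intro sum.cong refl) simp
  then have "of_real ((1 - r) * r ^ n) * ((\<Sum>\<xi>\<in>V.red n ` V. orbit_value n \<xi>) / of_nat (card (V.red n ` V))) =
      of_real (1 - r) * ((of_real (r ^ n) * of_real (r ^ n) powr (s - of_nat d - 1))
        * (1 / of_nat (card (V.red n ` V))) * ?S)"
    by (simp only: of_real_mult rearrange)
  also have "of_real (r ^ n) * of_real (r ^ n) powr (s - of_nat d - 1) * (1 / of_nat (card (V.red n ` V))) = T ^ n"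
  proof -
    have "1 / of_nat (card (V.red n ` V)) = (of_real (r ^ n) :: complex) ^ d"
      unfolding card_V_mod by (simp add: power_divide)
    also have "\<dots> = of_real (r ^ n) powr (of_nat d)" by (rule powr_complexpow[OF nz, symmetric])
    finally have "of_real (r ^ n) * of_real (r ^ n) powr (s - of_nat d - 1) * (1 / of_nat (card (V.red n ` V))) =
        of_real (r ^ n) powr (s - of_nat d) * (of_real (r ^ n) :: complex) powr (of_nat d)"
      by (simp only: r_pow_mult_powr)
    also have "\<dots> = of_real (r ^ n) powr s" by (simp only: powr_add[symmetric] diff_add_cancel)
    finally show ?thesis by (simp only: of_real_r_pow_powr)
  qed
  also have "?S = (\<Sum>\<alpha>\<in>M.red n ` M. of_nat (card (row_kernel (Q n) d e \<alpha>))) / of_nat (card (M.red n ` M))"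
    unfolding V_mod by (rule cring.average_kernel_size[OF cring_Quot finite_Quot subgroup_M_mod, symmetric])
  also have "\<dots> = fps_nth (ask_zeta v d e M) n"
    by (simp only: ask_zeta_def fps_nth_Abs_fps matrices_mod_eq)
  finally show ?thesis by (simp only: mult.commute)
qed

lemma kernel_integral:
  "integrable M.\<mu> kernel_integrand"
  "(\<lambda>n. of_real (1 - r) * (fps_nth (ask_zeta v d e M) n * T ^ n)) sums integral\<^sup>L M.\<mu> kernel_integrand"
proof -
  have sm: "summable (\<lambda>n. r ^ n * ((\<Sum>\<alpha>\<in>M.red n ` M. norm (kernel_value n \<alpha>)) / card (M.red n ` M)))"
    using norm_kernel_value_le Re_s M.red_nonempty by (intro summable_averages[where c = "Re s - real d"]) auto
  note I = M.integral_locally_constant[where \<Phi> = kernel_integrand and h = kernel_value, OF kernel_integrand_level _ sm]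
  show "integrable M.\<mu> kernel_integrand" by (rule I(1)) (simp_all add: kernel_integrand_def)
  have "(\<lambda>n. of_real ((1 - r) * r ^ n) * ((\<Sum>\<alpha>\<in>M.red n ` M. kernel_value n \<alpha>) / of_nat (card (M.red n ` M)))) sums
      integral\<^sup>L M.\<mu> kernel_integrand"
    by (rule I(2)) (simp_all add: kernel_integrand_def)
  then show "(\<lambda>n. of_real (1 - r) * (fps_nth (ask_zeta v d e M) n * T ^ n)) sums integral\<^sup>L M.\<mu> kernel_integrand"
    unfolding kernel_coefficient .
qed

lemma orbit_integral:
  "integrable V.\<mu> orbit_integrand"
  "(\<lambda>n. of_real (1 - r) * (fps_nth (ask_zeta v d e M) n * T ^ n)) sums integral\<^sup>L V.\<mu> orbit_integrand"
proof -
  have sm: "summable (\<lambda>n. r ^ n * ((\<Sum>\<xi>\<in>V.red n ` V. norm (orbit_value n \<xi>)) / card (V.red n ` V)))"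
    using norm_orbit_value_le Re_s V.red_nonempty by (intro summable_averages[where c = "Re s - real d"]) auto
  note I = V.integral_locally_constant[where \<Phi> = orbit_integrand and h = orbit_value, OF orbit_integrand_level _ sm]
  show "integrable V.\<mu> orbit_integrand" by (rule I(1)) (simp_all add: orbit_integrand_def)
  have "(\<lambda>n. of_real ((1 - r) * r ^ n) * ((\<Sum>\<xi>\<in>V.red n ` V. orbit_value n \<xi>) / of_nat (card (V.red n ` V)))) sums
      integral\<^sup>L V.\<mu> orbit_integrand"
    by (rule I(2)) (simp_all add: orbit_integrand_def)
  then show "(\<lambda>n. of_real (1 - r) * (fps_nth (ask_zeta v d e M) n * T ^ n)) sums integral\<^sup>L V.\<mu> orbit_integrand"
    unfolding orbit_coefficient .
qed

theorem zeta_integrals: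
  "summable (\<lambda>n. fps_nth (ask_zeta v d e M) n * T ^ n)"
  "of_real (1 - r) * eval_fps (ask_zeta v d e M) T = integral\<^sup>L M.\<mu> kernel_integrand"
  "integral\<^sup>L M.\<mu> kernel_integrand = integral\<^sup>L V.\<mu> orbit_integrand"
proof -
  have nz: "(of_real (1 - r) :: complex) \<noteq> 0" using r_less_1 by (simp only: of_real_eq_0_iff)
  show sm: "summable (\<lambda>n. fps_nth (ask_zeta v d e M) n * T ^ n)"
    using summable_mult_D[OF sums_summable[OF kernel_integral(2)] nz] .
  have "(\<lambda>n. of_real (1 - r) * (fps_nth (ask_zeta v d e M) n * T ^ n)) sums
      (of_real (1 - r) * eval_fps (ask_zeta v d e M) T)"
    unfolding eval_fps_def by (intro sums_mult summable_sums sm)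
  then show "of_real (1 - r) * eval_fps (ask_zeta v d e M) T = integral\<^sup>L M.\<mu> kernel_integrand"
    using kernel_integral(2) by (rule sums_unique2)
  show "integral\<^sup>L M.\<mu> kernel_integrand = integral\<^sup>L V.\<mu> orbit_integrand"
    using kernel_integral(2) orbit_integral(2) by (rule sums_unique2)
qed

end

theorem theorem4p5:
  fixes v :: "'a::field \<Rightarrow> real" and d e :: nat and M :: "(nat \<times> nat \<Rightarrow> 'a) set" and s :: complex
  assumes "nonarch_local_field v"
    and "submodule M (val_ring v) (matrix_module (val_ring v) d e)"
    and "Re s > real d"
  shows "let q = residue_size v;
             V = carrier (row_module (val_ring v) d);
             T = of_nat q powr (- s);
             \<mu> = haar_prod v ({..<d} \<times> {..<e}) M;
             \<nu> = haar_prod v {..<d} V;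
             F = (\<lambda>(a, y). of_real (v y) powr (s - 1) * of_nat (ask_K v d e a y));
             G = (\<lambda>(x, y). of_real (v y) powr (s - of_nat d - 1) / of_nat (ask_O v d e M x y))
         in summable (\<lambda>n. fps_nth (ask_zeta v d e M) n * T ^ n) \<and>
            integrable \<mu> F \<and> integrable \<nu> G \<and>
            (1 - 1 / of_nat q) * eval_fps (ask_zeta v d e M) T = integral\<^sup>L \<mu> F \<and>
            integral\<^sup>L \<mu> F = integral\<^sup>L \<nu> G"
proof -
  interpret ask_zeta_integrals v d e M s
    using assms by (intro ask_zeta_integrals.intro ask_zeta_integrals_axioms.intro)
  have "(of_real (1 - 1 / real (residue_size v)) :: complex) = 1 - 1 / of_nat (residue_size v)" by simp
  with zeta_integrals kernel_integral(1) orbit_integral(1) show ?thesis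
    unfolding Let_def kernel_integrand_def orbit_integrand_def by metis
qed

end
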